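(* Assume that Hypothesis (H) (stated in the context) holds, and let $\bar Z_{\tau\in[0,T]}$ be the Bernstein process associated (in the sense of the context) with the probability measure $\bar\mu$ on $\mathcal B_d\times\mathcal B_d$ with joint density $$\bar\mu(\mathsf x,\mathsf y)=\mathcal Z^{-1}(T)\,g(\mathsf x,T,\mathsf y)\,\delta(\mathsf x-\mathsf y).$$ Then the following statements are valid. (a) The process $\bar Z_{\tau\in[0,T]}$ is stationary, non-Markovian and for every $n\in\mathbb N^+$ with $n\ge2$ its finite-dimensional distributions are $$\mathbb P_{\bar\mu}\left(\bar Z_{t_1}\in F_1,\dots,\bar Z_{t_n}\in F_n\right)=\mathcal Z^{-1}(T)\int_{F_1}d\mathsf x_1\cdots\int_{F_n}d\mathsf x_n\prod_{k=2}^n g(\mathsf x_k,t_k-t_{k-1},\mathsf x_{k-1})\times g(\mathsf x_1,T-(t_n-t_1),\mathsf x_n)$$ for all $F_1,\dots,F_n\in\mathcal B_d$ and all $0<t_1<\dots<t_n<T$. (b) We have $$\mathbb P_{\bar\mu}(\bar Z_t\in F)=\mathcal Z^{-1}(T)\int_F d\mathsf x\,g(\mathsf x,T,\mathsf x)$$ for each $F\in\mathcal B_d$ and every $t\in[0,T]$. (c) We have $$\mathbb E_{\bar\mu}\left(b(\bar Z_t)\right)=\mathcal Z^{-1}(T)\int_{\mathbb R^d}d\mathsf x\,b(\mathsf x)g(\mathsf x,T,\mathsf x)$$ for each bounded Borel measurable function $b:\mathbb R^d\to\mathbb C$ and every $t\in[0,T]$.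
   Context: Fix $d\in\mathbb N^+$ and $T\in(0,+\infty)$; $\mathcal B_d$ is the Borel $\sigma$-algebra of $\mathbb R^d$; $\mathbb N=\{0,1,2,\dots\}$; $\delta$ is the Dirac measure. Hypothesis (H): the real-valued function $V$ on $\mathbb R^d$ is bounded from below, $V\in L^\infty_{loc}(\mathbb R^d)$, and $V(\mathsf x)\to+\infty$ as $|\mathsf x|\to+\infty$. $H=-\frac12\Delta_{\mathsf x}+V$ denotes the self-adjoint operator in $L^2(\mathbb R^d)$ associated with the closure of the quadratic form $\mathsf Q(f)=\frac12\sum_{j=1}^d\int|\partial_{x_j}f|^2d\mathsf x+\int V|f|^2d\mathsf x$ defined first on smooth compactly supported complex-valued $f$. It has compact resolvent; its eigenvalues $(E_{\mathsf m})_{\mathsf m\in\mathbb N^d}$ satisfy $E_{\mathsf m}\to+\infty$ as $|\mathsf m|\to+\infty$. Standing assumption: $\mathcal Z(t)=\sum_{\mathsf m\in\mathbb N^d}\exp[-tE_{\mathsf m}]<+\infty$ for every $t\in(0,T]$. Green's function $g(\mathsf x,t,\mathsf y)$ is the (continuous, strictly positive, symmetric in $\mathsf x,\mathsf y$) integral kernel of the semigroup $\exp[-tH]$, $t\in(0,T]$. Bernstein process: an $\mathbb R^d$-valued process $Z_{\tau\in[0,T]}$ on a complete probability space $(\Omega,\mathcal F,\mathbb P)$ such that $\mathbb E(b(Z_r)\mid\mathcal F_s^+\vee\mathcal F_t^-)=\mathbb E(b(Z_r)\mid Z_s,Z_t)$ $\mathbb P$-a.e. for every bounded Borel $b:\mathbb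 R^d\to\mathbb C$ and all $r\in(s,t)\subset[0,T]$, where $\mathcal F_s^+=\sigma\{Z_\tau^{-1}(F):\tau\le s,F\in\mathcal B_d\}$ and $\mathcal F_t^-=\sigma\{Z_\tau^{-1}(F):\tau\ge t,F\in\mathcal B_d\}$. Given a probability measure $\mu$ on $\mathcal B_d\times\mathcal B_d$, the Bernstein process associated with $\mu$ is the Bernstein process on a probability space $(\Omega,\mathcal F,\mathbb P_\mu)$ whose law is determined by $$\mathbb P_\mu(Z_0\in F_0,Z_{t_1}\in F_1,\dots,Z_{t_n}\in F_n,Z_T\in F_T)=\int_{F_0\times F_T}\frac{d\mu(\mathsf x,\mathsf y)}{g(\mathsf x,T,\mathsf y)}\int_{F_1}d\mathsf x_1\cdots\int_{F_n}d\mathsf x_n\prod_{k=1}^n g(\mathsf x_k,t_k-t_{k-1},\mathsf x_{k-1})\,g(\mathsf y,T-t_n,\mathsf x_n)$$ for all Borel $F_0,\dots,F_n,F_T$ and $t_0=0<t_1<\dots<t_n<T$, with $\mathsf x_0=\mathsf x$. $\mathbb E_\mu$ is expectation under $\mathbb P_\mu$. A process is stationary if its finite-dimensional distributions are invariant under time translations (within the time interval). *)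

theory Defs
  imports "HOL-Probability.Probability"
begin

section \<open>The Schroedinger operator $H = -\frac12\Delta + V$\<close>

definition hypothesis_H :: "(real ^ 'd \<Rightarrow> real) \<Rightarrow> bool" where
  "hypothesis_H V \<longleftrightarrow>
     (\<exists>c. \<forall>x. c \<le> V x) \<and>
     V \<in> borel_measurable lebesgue \<and>
     (\<forall>K. compact K \<longrightarrow> (\<exists>C. AE x in lebesgue. x \<in> K \<longrightarrow> \<bar>V x\<bar> \<le> C)) \<and>
     filterlim V at_top at_infinity"

text \<open>Elements of $L^2$ are represented by functions; equality in $L^2$ is a.e. equality.
  The inner product is linear in its first argument.\<close>

definition L2 :: "(real ^ 'd \<Rightarrow> complex) set" where
  "L2 = {f. f \<in> borel_measurable lebesgue \<and> integrable lebesgue (\<lambda>x. (cmod (f x))\<^sup>2)}"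

definition L2_inner :: "(real ^ 'd \<Rightarrow> complex) \<Rightarrow> (real ^ 'd \<Rightarrow> complex) \<Rightarrow> complex" where
  "L2_inner f g = (LINT x|lebesgue. f x * cnj (g x))"

definition L2_norm :: "(real ^ 'd \<Rightarrow> complex) \<Rightarrow> real" where
  "L2_norm f = sqrt (LINT x|lebesgue. (cmod (f x))\<^sup>2)"

definition partial :: "'d \<Rightarrow> (real ^ 'd \<Rightarrow> complex) \<Rightarrow> real ^ 'd \<Rightarrow> complex" where
  "partial j f x = vector_derivative (\<lambda>s. f (x + s *\<^sub>R axis j 1)) (at 0)"

primrec C_k :: "nat \<Rightarrow> (real ^ 'd \<Rightarrow> complex) \<Rightarrow> bool" where
  "C_k 0 f \<longleftrightarrow> continuous_on UNIV f"
| "C_k (Suc k) f \<longleftrightarrow> f differentiable_on UNIV \<and> (\<forall>j. C_k k (partial j f))"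

definition test_function :: "(real ^ 'd \<Rightarrow> complex) \<Rightarrow> bool" where
  "test_function f \<longleftrightarrow> (\<forall>k. C_k k f) \<and> compact (closure {x. f x \<noteq> 0})"

text \<open>The sesquilinear form whose diagonal is the quadratic form
  $Q(f) = \frac12\sum_j\int|\partial_j f|^2 + \int V|f|^2$.\<close>

definition Q_form ::
  "(real ^ 'd \<Rightarrow> real) \<Rightarrow> (real ^ 'd \<Rightarrow> complex) \<Rightarrow> (real ^ 'd \<Rightarrow> complex) \<Rightarrow> complex" where
  "Q_form V f g = 1/2 * (\<Sum>j\<in>UNIV. LINT x|lebesgue. partial j f x * cnj (partial j g x))
                  + (LINT x|lebesgue. complex_of_real (V x) * f x * cnj (g x))"

text \<open>Since $Q$ is bounded below and the sequence converges in $L^2$, the last condition says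
  that the sequence is Cauchy in the form norm.\<close>

definition form_approx ::
  "(real ^ 'd \<Rightarrow> real) \<Rightarrow> (nat \<Rightarrow> real ^ 'd \<Rightarrow> complex) \<Rightarrow> (real ^ 'd \<Rightarrow> complex) \<Rightarrow> bool" where
  "form_approx V \<phi> f \<longleftrightarrow>
     (\<forall>n. test_function (\<phi> n)) \<and>
     (\<lambda>n. L2_norm (\<lambda>x. \<phi> n x - f x)) \<longlonglongrightarrow> 0 \<and>
     (\<forall>\<epsilon>>0. \<exists>N. \<forall>m\<ge>N. \<forall>n\<ge>N.
        cmod (Q_form V (\<lambda>x. \<phi> m x - \<phi> n x) (\<lambda>x. \<phi> m x - \<phi> n x)) < \<epsilon>)"

definition closed_form_domain :: "(real ^ 'd \<Rightarrow> real) \<Rightarrow> (real ^ 'd \<Rightarrow> complex) set" where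
  "closed_form_domain V = {f \<in> L2. \<exists>\<phi>. form_approx V \<phi> f}"

definition closed_form ::
  "(real ^ 'd \<Rightarrow> real) \<Rightarrow> (real ^ 'd \<Rightarrow> complex) \<Rightarrow> (real ^ 'd \<Rightarrow> complex) \<Rightarrow> complex" where
  "closed_form V f g =
     (THE q. \<forall>\<phi> \<gamma>. form_approx V \<phi> f \<longrightarrow> form_approx V \<gamma> g \<longrightarrow>
        (\<lambda>n. Q_form V (\<phi> n) (\<gamma> n)) \<longlonglongrightarrow> q)"

text \<open>The self-adjoint operator $H$ associated with the closed form, as a relation:
  \<open>schroedinger_op V f u\<close> means that $f$ is in the domain of $H$ and $Hf = u$.\<close>

definition schroedinger_op ::
  "(real ^ 'd \<Rightarrow> real) \<Rightarrow> (real ^ 'd \<Rightarrow> complex) \<Rightarrow> (real ^ 'd \<Rightarrow> complex) \<Rightarrow> bool" where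
  "schroedinger_op V f u \<longleftrightarrow>
     f \<in> closed_form_domain V \<and> u \<in> L2 \<and>
     (\<forall>\<psi>\<in>closed_form_domain V. closed_form V f \<psi> = L2_inner u \<psi>)"

text \<open>$(h_m)$ is an orthonormal basis of $L^2$ consisting of eigenfunctions of $H$; hence
  $(E_m)$ lists all eigenvalues of $H$, repeated according to multiplicity.\<close>

definition eigen_system ::
  "(real ^ 'd \<Rightarrow> real) \<Rightarrow> (nat ^ 'd \<Rightarrow> real) \<Rightarrow> (nat ^ 'd \<Rightarrow> real ^ 'd \<Rightarrow> complex) \<Rightarrow> bool" where
  "eigen_system V E h \<longleftrightarrow>
     (\<forall>m. schroedinger_op V (h m) (\<lambda>x. complex_of_real (E m) * h m x)) \<and>
     (\<forall>m n. L2_inner (h m) (h n) = (if m = n then 1 else 0)) \<and>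
     (\<forall>f\<in>L2. (\<forall>m. L2_inner f (h m) = 0) \<longrightarrow> (AE x in lebesgue. f x = 0))"

definition partition_function :: "(nat ^ 'd \<Rightarrow> real) \<Rightarrow> real \<Rightarrow> real" where
  "partition_function E t = (\<Sum>\<^sub>\<infinity>m. exp (- t * E m))"

text \<open>Functional calculus of the operator with pure point spectrum given by an eigensystem:
  $\varphi(H) f = \sum_m \varphi(E_m)\langle f, h_m\rangle h_m$ with convergence in $L^2$. As a
  relation, \<open>functional_calculus E h \<phi> f u\<close> means that $\varphi(H) f = u$ in $L^2$. The operator
  does not depend on the choice of the eigenbasis.\<close>

definition functional_calculus ::
  "(nat ^ 'd \<Rightarrow> real) \<Rightarrow> (nat ^ 'd \<Rightarrow> real ^ 'd \<Rightarrow> complex) \<Rightarrow> (real \<Rightarrow> real) \<Rightarrow>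
   (real ^ 'd \<Rightarrow> complex) \<Rightarrow> (real ^ 'd \<Rightarrow> complex) \<Rightarrow> bool" where
  "functional_calculus E h \<phi> f u \<longleftrightarrow>
     u \<in> L2 \<and>
     ((\<lambda>A. L2_norm (\<lambda>x. u x - (\<Sum>m\<in>A. complex_of_real (\<phi> (E m)) * L2_inner f (h m) * h m x)))
        \<longlongrightarrow> 0) (finite_subsets_at_top UNIV)"

definition greens_function ::
  "real \<Rightarrow> (nat ^ 'd \<Rightarrow> real) \<Rightarrow> (nat ^ 'd \<Rightarrow> real ^ 'd \<Rightarrow> complex) \<Rightarrow>
   (real ^ 'd \<Rightarrow> real \<Rightarrow> real ^ 'd \<Rightarrow> real) \<Rightarrow> bool" where
  "greens_function T E h g \<longleftrightarrow>
     continuous_on (UNIV \<times> {0<..T} \<times> UNIV) (\<lambda>(x, t, y). g x t y) \<and>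
     (\<forall>x y. \<forall>t\<in>{0<..T}. 0 < g x t y) \<and>
     (\<forall>x y. \<forall>t\<in>{0<..T}. g x t y = g y t x) \<and>
     (\<forall>t\<in>{0<..T}. \<forall>f\<in>L2.
        (AE x in lebesgue. integrable lebesgue (\<lambda>y. complex_of_real (g x t y) * f y)) \<and>
        functional_calculus E h (\<lambda>e. exp (- t * e)) f
          (\<lambda>x. LINT y|lebesgue. complex_of_real (g x t y) * f y))"


section \<open>Bernstein processes\<close>

definition gen_sigma :: "'w measure \<Rightarrow> (real \<Rightarrow> 'w \<Rightarrow> real ^ 'd) \<Rightarrow> real set \<Rightarrow> 'w measure" where
  "gen_sigma M Z I =
     sigma (space M) {Z \<tau> -` F \<inter> space M | \<tau> F. \<tau> \<in> I \<and> F \<in> sets borel}"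

definition join_sigma :: "'w measure \<Rightarrow> 'w measure \<Rightarrow> 'w measure" where
  "join_sigma G G' = sigma (space G) (sets G \<union> sets G')"

definition complex_cond_exp ::
  "'w measure \<Rightarrow> 'w measure \<Rightarrow> ('w \<Rightarrow> complex) \<Rightarrow> 'w \<Rightarrow> complex" where
  "complex_cond_exp M G f \<omega> =
     Complex (real_cond_exp M G (\<lambda>w. Re (f w)) \<omega>) (real_cond_exp M G (\<lambda>w. Im (f w)) \<omega>)"

definition process_on :: "'w measure \<Rightarrow> real \<Rightarrow> (real \<Rightarrow> 'w \<Rightarrow> real ^ 'd) \<Rightarrow> bool" where
  "process_on M T Z \<longleftrightarrow>
     prob_space M \<and> complete_measure M \<and> (\<forall>\<tau>\<in>{0..T}. Z \<tau> \<in> borel_measurable M)"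

definition bernstein_process :: "'w measure \<Rightarrow> real \<Rightarrow> (real \<Rightarrow> 'w \<Rightarrow> real ^ 'd) \<Rightarrow> bool" where
  "bernstein_process M T Z \<longleftrightarrow>
     process_on M T Z \<and>
     (\<forall>(b :: real ^ 'd \<Rightarrow> complex) s r t.
        b \<in> borel_measurable borel \<longrightarrow> bounded (range b) \<longrightarrow>
        0 \<le> s \<longrightarrow> s < r \<longrightarrow> r < t \<longrightarrow> t \<le> T \<longrightarrow>
        (AE \<omega> in M.
           complex_cond_exp M (join_sigma (gen_sigma M Z {0..s}) (gen_sigma M Z {t..T}))
             (\<lambda>w. b (Z r w)) \<omega>
           = complex_cond_exp M (gen_sigma M Z {s, t}) (\<lambda>w. b (Z r w)) \<omega>))"

definition markov_process :: "'w measure \<Rightarrow> real \<Rightarrow> (real \<Rightarrow> 'w \<Rightarrow> real ^ 'd) \<Rightarrow> bool" where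
  "markov_process M T Z \<longleftrightarrow>
     process_on M T Z \<and>
     (\<forall>(b :: real ^ 'd \<Rightarrow> complex) s t.
        b \<in> borel_measurable borel \<longrightarrow> bounded (range b) \<longrightarrow>
        0 \<le> s \<longrightarrow> s \<le> t \<longrightarrow> t \<le> T \<longrightarrow>
        (AE \<omega> in M.
           complex_cond_exp M (gen_sigma M Z {0..s}) (\<lambda>w. b (Z t w)) \<omega>
           = complex_cond_exp M (gen_sigma M Z {s}) (\<lambda>w. b (Z t w)) \<omega>))"

definition fin_dim_distr ::
  "'w measure \<Rightarrow> (real \<Rightarrow> 'w \<Rightarrow> real ^ 'd) \<Rightarrow> nat \<Rightarrow> (nat \<Rightarrow> real) \<Rightarrow> (nat \<Rightarrow> real ^ 'd) measure" where
  "fin_dim_distr M Z n t =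
     distr M (\<Pi>\<^sub>M k\<in>{1..n}. borel) (\<lambda>\<omega>. \<lambda>k\<in>{1..n}. Z (t k) \<omega>)"

definition stationary_process :: "'w measure \<Rightarrow> real \<Rightarrow> (real \<Rightarrow> 'w \<Rightarrow> real ^ 'd) \<Rightarrow> bool" where
  "stationary_process M T Z \<longleftrightarrow>
     process_on M T Z \<and>
     (\<forall>n t \<tau>. (\<forall>k\<in>{1..n}. t k \<in> {0..T} \<and> t k + \<tau> \<in> {0..T}) \<longrightarrow>
        fin_dim_distr M Z n (\<lambda>k. t k + \<tau>) = fin_dim_distr M Z n t)"

text \<open>Iterated integrals over $F_1,\dots,F_n$ are integrals with respect to the $n$-fold product of
  Lebesgue measure over functions on \<open>{1..n}\<close>; \<open>x(0 := fst p)\<close> sets $x_0 = \mathsf x$ for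
  $p = (\mathsf x, \mathsf y)$.\<close>

definition bernstein_associated ::
  "(real ^ 'd \<Rightarrow> real \<Rightarrow> real ^ 'd \<Rightarrow> real) \<Rightarrow> ((real ^ 'd) \<times> (real ^ 'd)) measure \<Rightarrow>
   'w measure \<Rightarrow> real \<Rightarrow> (real \<Rightarrow> 'w \<Rightarrow> real ^ 'd) \<Rightarrow> bool" where
  "bernstein_associated g \<mu> M T Z \<longleftrightarrow>
     prob_space \<mu> \<and> sets \<mu> = sets (borel \<Otimes>\<^sub>M borel :: ((real ^ 'd) \<times> (real ^ 'd)) measure) \<and>
     bernstein_process M T Z \<and>
     (\<forall>(n::nat)\<ge>1. \<forall>t F F0 FT.
        t 0 = 0 \<longrightarrow> (\<forall>k\<in>{1..n}. t (k - 1) < t k) \<longrightarrow> t n < T \<longrightarrow>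
        F0 \<in> sets borel \<longrightarrow> (\<forall>k\<in>{1..n}. F k \<in> sets borel) \<longrightarrow> FT \<in> sets borel \<longrightarrow>
        emeasure M {\<omega> \<in> space M. Z 0 \<omega> \<in> F0 \<and> (\<forall>k\<in>{1..n}. Z (t k) \<omega> \<in> F k) \<and> Z T \<omega> \<in> FT}
        = (\<integral>\<^sup>+ p \<in> F0 \<times> FT.
             (\<integral>\<^sup>+ x \<in> Pi\<^sub>E {1..n} F.
                ennreal ((\<Prod>k=1..n. g ((x(0 := fst p)) k) (t k - t (k - 1)) ((x(0 := fst p)) (k - 1)))
                         * g (snd p) (T - t n) (x n))
              \<partial>(\<Pi>\<^sub>M k\<in>{1..n}. lborel))
             / ennreal (g (fst p) T (snd p)) \<partial>\<mu>))"

text \<open>The measure $\delta(\mathsf x - \mathsf y)\,d\mathsf x\,d\mathsf y$.\<close>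

definition diagonal_measure :: "((real ^ 'd) \<times> (real ^ 'd)) measure" where
  "diagonal_measure = distr lborel (borel \<Otimes>\<^sub>M borel) (\<lambda>x. (x, x))"

definition mu_bar ::
  "real \<Rightarrow> (nat ^ 'd \<Rightarrow> real) \<Rightarrow> (real ^ 'd \<Rightarrow> real \<Rightarrow> real ^ 'd \<Rightarrow> real) \<Rightarrow>
   ((real ^ 'd) \<times> (real ^ 'd)) measure" where
  "mu_bar T E g =
     density diagonal_measure (\<lambda>(x, y). ennreal (inverse (partition_function E T) * g x T y))"

end

theory Submission
  imports Defs
begin

text \<open>
  Let $c = \mathcal Z(T)^{-1}$. For the diagonal measure the Bernstein formula reads: pick a point $x$
  with density $c\,g(x,T,x)$ and run the bridge from $x$ to $x$ (\<open>bernstein_loop_process\<close>). The process is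
  thus a random loop, and everything follows from one cyclic formula (\<open>loop_law\<close>): at times
  $t_1 < \dots < t_n$ its joint density is $c$ times the product of the kernels
  $g(x_k, t_k - t_{k-1}, x_{k-1})$ around the loop, closed up by $g(x_1, T-(t_n-t_1), x_n)$.

  To obtain it for interior times, the base point $x$ has to be integrated out, which calls for the
  Chapman--Kolmogorov equation, also on the diagonal when $n = 1$. The semigroup law of $e^{-tH}$ is an
  identity in $L^2$ and yields an equation of kernels almost everywhere only. What it does yield at
  every point, through Fatou's lemma and continuity, is the inequality
  $\int g(x,s,z)\,g(z,t,y)\,dz \le g(x,s+t,y)$ (\<open>sub_Chapman_Kolmogorov\<close>). This is enough: the density of
  the process is bounded by the cyclic product, the density has total mass one because it belongs to a
  probability, and the cyclic product has total mass one because it depends on time differences only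
  and is the exact density when $t_n = T$ (for $n = 1$, because the initial-final measure is a
  probability). Ordered functions with equal finite integrals agree almost everywhere
  (\<open>nn_set_integral_eq_of_total\<close>).

  Stationarity is immediate, since translating the times leaves the cyclic product unchanged; if $0$
  and $T$ both occur, no nonzero translation is possible. The one-time marginals are the case $n = 1$.

  The process is not Markovian because it remembers its starting point: $Z_T = Z_0$ is known
  from the past, whereas $(Z_0, Z_s)$ has a strictly positive density for $0 < s < T$, so that $Z_s$
  decides no nontrivial event about $Z_0$ (\<open>loop_process_not_markov\<close>).
\<close>

section \<open>Square-integrable functions and the functional calculus\<close>

lemma L2_I:
  "f \<in> borel_measurable lebesgue \<Longrightarrow> integrable lebesgue (\<lambda>x. (cmod (f x))\<^sup>2) \<Longrightarrow> f \<in> L2"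
  by (simp add: L2_def)

lemma L2_measurable: "f \<in> L2 \<Longrightarrow> f \<in> borel_measurable lebesgue"
  by (simp add: L2_def)

lemma cmod_add_sq_le: "(cmod (a + b))\<^sup>2 \<le> 2 * (cmod a)\<^sup>2 + 2 * (cmod b)\<^sup>2"
proof -
  have "(cmod (a + b))\<^sup>2 \<le> (cmod a + cmod b)\<^sup>2"
    by (intro power_mono norm_triangle_ineq) auto
  also have "\<dots> \<le> 2 * (cmod a)\<^sup>2 + 2 * (cmod b)\<^sup>2"
    using sum_squares_ge_zero[of "cmod a - cmod b" 0] by (simp add: power2_eq_square algebra_simps)
  finally show ?thesis .
qed

lemma L2_add:
  assumes "f \<in> L2" "g \<in> L2" shows "(\<lambda>x. f x + g x) \<in> L2"
proof (rule L2_I)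
  have [measurable]: "f \<in> borel_measurable lebesgue" "g \<in> borel_measurable lebesgue"
    using assms by (auto simp: L2_def)
  show "(\<lambda>x. f x + g x) \<in> borel_measurable lebesgue" by measurable
  show "integrable lebesgue (\<lambda>x. (cmod (f x + g x))\<^sup>2)"
  proof (rule Bochner_Integration.integrable_bound)
    show "integrable lebesgue (\<lambda>x. 2 * (cmod (f x))\<^sup>2 + 2 * (cmod (g x))\<^sup>2)"
      using assms by (auto simp: L2_def)
  qed (use cmod_add_sq_le in auto)
qed

lemma L2_scale: assumes "f \<in> L2" shows "(\<lambda>x. c * f x) \<in> L2"
proof (rule L2_I)
  have [measurable]: "f \<in> borel_measurable lebesgue" using assms by (auto simp: L2_def)
  show "(\<lambda>x. c * f x) \<in> borel_measurable lebesgue" by measurable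
  show "integrable lebesgue (\<lambda>x. (cmod (c * f x))\<^sup>2)"
    using assms by (auto simp: L2_def norm_mult power_mult_distrib)
qed

lemma L2_diff: assumes "f \<in> L2" "g \<in> L2" shows "(\<lambda>x. f x - g x) \<in> L2"
  using L2_add[OF assms(1) L2_scale[OF assms(2), of "-1"]] by simp

lemma L2_zero: "(\<lambda>x. 0) \<in> L2"
  by (rule L2_I) auto

lemma L2_sum: "finite A \<Longrightarrow> (\<And>m. m \<in> A \<Longrightarrow> f m \<in> L2) \<Longrightarrow> (\<lambda>x. \<Sum>m\<in>A. f m x) \<in> L2"
  by (induction A rule: finite_induct) (auto intro: L2_zero L2_add)

lemma L2_norm_nonneg: "0 \<le> L2_norm f" unfolding L2_norm_def by simp

lemma L2_norm_sq: "(L2_norm f)\<^sup>2 = (LINT x|lebesgue. (cmod (f x))\<^sup>2)"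
  unfolding L2_norm_def by (simp add: integral_nonneg_AE)

lemma integrable_L2_inner:
  assumes "f \<in> L2" "g \<in> L2"
  shows "integrable lebesgue (\<lambda>x. f x * cnj (g x))"
proof (rule Bochner_Integration.integrable_bound)
  have [measurable]: "f \<in> borel_measurable lebesgue" "g \<in> borel_measurable lebesgue"
    using assms by (auto simp: L2_def)
  show "(\<lambda>x. f x * cnj (g x)) \<in> borel_measurable lebesgue"
    using borel_measurable_continuous_onI[OF continuous_on_cnj[OF continuous_on_id]]
    by measurable
  show "integrable lebesgue (\<lambda>x. (cmod (f x))\<^sup>2 + (cmod (g x))\<^sup>2)"
    using assms by (auto simp: L2_def)
  show "AE x in lebesgue. norm (f x * cnj (g x)) \<le> norm ((cmod (f x))\<^sup>2 + (cmod (g x))\<^sup>2)"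
  proof (rule AE_I2)
    fix x
    have "0 \<le> (cmod (f x) - cmod (g x))\<^sup>2 + (cmod (f x))\<^sup>2 + (cmod (g x))\<^sup>2" by simp
    then have "2 * (cmod (f x) * cmod (g x)) \<le> 2 * ((cmod (f x))\<^sup>2 + (cmod (g x))\<^sup>2)"
      by (simp add: power2_eq_square algebra_simps)
    then show "norm (f x * cnj (g x)) \<le> norm ((cmod (f x))\<^sup>2 + (cmod (g x))\<^sup>2)"
      by (simp add: norm_mult)
  qed
qed

lemma L2_Cauchy_Schwarz:
  assumes "f \<in> L2" "g \<in> L2"
  shows "cmod (L2_inner f g) \<le> L2_norm f * L2_norm g"
proof -
  have [measurable]: "f \<in> borel_measurable lebesgue" "g \<in> borel_measurable lebesgue"
    using assms by (auto simp: L2_def)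
  let ?I = "LINT x|lebesgue. cmod (f x) * cmod (g x)"
  have int: "integrable lebesgue (\<lambda>x. cmod (f x) * cmod (g x))"
    using integrable_norm[OF integrable_L2_inner[OF assms]] by (simp add: norm_mult)
  have I: "ennreal ?I = (\<integral>\<^sup>+ x. ennreal (cmod (f x)) * ennreal (cmod (g x)) \<partial>lebesgue)"
    using nn_integral_eq_integral[OF int] by (simp add: ennreal_mult)
  have sq: "(\<integral>\<^sup>+ x. (ennreal (cmod (u x)))\<^sup>2 \<partial>lebesgue) = ennreal ((L2_norm u)\<^sup>2)" 
    if "u \<in> L2" for u :: "real ^ 'a \<Rightarrow> complex"
    using that nn_integral_eq_integral[of lebesgue "\<lambda>x. (cmod (u x))\<^sup>2"]
    by (simp add: L2_norm_sq L2_def ennreal_power)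
  have "(ennreal ?I)\<^sup>2 \<le> ennreal ((L2_norm f)\<^sup>2) * ennreal ((L2_norm g)\<^sup>2)"
    unfolding I sq[OF assms(1), symmetric] sq[OF assms(2), symmetric]
    by (rule Cauchy_Schwarz_nn_integral) auto
  then have "?I\<^sup>2 \<le> (L2_norm f * L2_norm g)\<^sup>2"
    by (simp add: ennreal_power ennreal_mult[symmetric] power_mult_distrib integral_nonneg_AE)
  then have le: "?I \<le> L2_norm f * L2_norm g"
    by (rule power2_le_imp_le) (simp add: L2_norm_nonneg)
  have "cmod (L2_inner f g) \<le> (LINT x|lebesgue. cmod (f x * cnj (g x)))"
    unfolding L2_inner_def by (rule integral_norm_bound)
  then show ?thesis using le by (simp add: norm_mult)
qed

lemma L2_inner_diff_left:
  assumes "f \<in> L2" "g \<in> L2" "k \<in> L2"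
  shows "L2_inner (\<lambda>x. f x - g x) k = L2_inner f k - L2_inner g k"
  unfolding L2_inner_def
  using integrable_L2_inner[OF assms(1,3)] integrable_L2_inner[OF assms(2,3)]
  by (simp add: left_diff_distrib)

lemma L2_inner_sum_left:
  assumes "\<And>m. m \<in> A \<Longrightarrow> f m \<in> L2" "k \<in> L2"
  shows "L2_inner (\<lambda>x. \<Sum>m\<in>A. c m * f m x) k = (\<Sum>m\<in>A. c m * L2_inner (f m) k)"
proof -
  have "L2_inner (\<lambda>x. \<Sum>m\<in>A. c m * f m x) k = (LINT x|lebesgue. (\<Sum>m\<in>A. c m * (f m x * cnj (k x))))"
    unfolding L2_inner_def by (simp add: sum_distrib_right mult.assoc)
  also have "\<dots> = (\<Sum>m\<in>A. c m * L2_inner (f m) k)"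
    unfolding L2_inner_def
    by (subst Bochner_Integration.integral_sum) (auto intro!: sum.cong integrable_L2_inner assms)
  finally show ?thesis .
qed

text \<open>The two functions are $L^2$ limits of the same net of partial sums $S_A$, and
  $|u - v|^2 \le 2|u - S_A|^2 + 2|v - S_A|^2$ pointwise.\<close>

lemma functional_calculus_unique:
  assumes h: "\<And>m. h m \<in> L2"
    and u: "functional_calculus E h \<phi> f u" and v: "functional_calculus E h \<phi> f v"
  shows "AE x in lebesgue. u x = v x"
proof -
  define S where "S A = (\<lambda>x. \<Sum>m\<in>A. complex_of_real (\<phi> (E m)) * L2_inner f (h m) * h m x)" for A
  have S: "S A \<in> L2" if "finite A" for A
    unfolding S_def using that by (intro L2_sum L2_scale h) 
  have uL: "u \<in> L2" and vL: "v \<in> L2" using u v by (auto simp: functional_calculus_def)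
  note [measurable] = L2_measurable[OF uL] L2_measurable[OF vL]
  have ut: "((\<lambda>A. L2_norm (\<lambda>x. u x - S A x)) \<longlongrightarrow> 0) (finite_subsets_at_top UNIV)"
    and vt: "((\<lambda>A. L2_norm (\<lambda>x. v x - S A x)) \<longlongrightarrow> 0) (finite_subsets_at_top UNIV)"
    using u v by (auto simp: functional_calculus_def S_def)
  have bd: "(L2_norm (\<lambda>x. u x - v x))\<^sup>2 \<le>
      2 * (L2_norm (\<lambda>x. u x - S A x))\<^sup>2 + 2 * (L2_norm (\<lambda>x. v x - S A x))\<^sup>2" if A: "finite A" for A
  proof -
    have "(LINT x|lebesgue. (cmod (u x - v x))\<^sup>2)
        \<le> (LINT x|lebesgue. 2 * (cmod (u x - S A x))\<^sup>2 + 2 * (cmod (v x - S A x))\<^sup>2)"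
    proof (rule integral_mono)
      fix x show "(cmod (u x - v x))\<^sup>2 \<le> 2 * (cmod (u x - S A x))\<^sup>2 + 2 * (cmod (v x - S A x))\<^sup>2"
        using cmod_add_sq_le[of "u x - S A x" "S A x - v x"] by (simp add: norm_minus_commute)
    qed (use L2_diff[OF uL vL] L2_diff[OF uL S[OF A]] L2_diff[OF vL S[OF A]] in \<open>auto simp: L2_def\<close>)
    also have "\<dots> = 2 * (L2_norm (\<lambda>x. u x - S A x))\<^sup>2 + 2 * (L2_norm (\<lambda>x. v x - S A x))\<^sup>2"
      using L2_diff[OF uL S[OF A]] L2_diff[OF vL S[OF A]] by (simp add: L2_def L2_norm_sq)
    finally show ?thesis by (simp add: L2_norm_sq)
  qed
  have "(L2_norm (\<lambda>x. u x - v x))\<^sup>2 \<le> 2 * 0\<^sup>2 + 2 * 0\<^sup>2"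
  proof (rule tendsto_lowerbound)
    show "((\<lambda>A. 2 * (L2_norm (\<lambda>x. u x - S A x))\<^sup>2 + 2 * (L2_norm (\<lambda>x. v x - S A x))\<^sup>2)
        \<longlongrightarrow> 2 * 0\<^sup>2 + 2 * 0\<^sup>2) (finite_subsets_at_top UNIV)"
      by (intro tendsto_intros ut vt)
    show "eventually (\<lambda>A. (L2_norm (\<lambda>x. u x - v x))\<^sup>2 \<le>
      2 * (L2_norm (\<lambda>x. u x - S A x))\<^sup>2 + 2 * (L2_norm (\<lambda>x. v x - S A x))\<^sup>2) (finite_subsets_at_top UNIV)"
      using bd by (auto intro: eventually_finite_subsets_at_top_weakI)
  qed auto
  then have "(LINT x|lebesgue. (cmod (u x - v x))\<^sup>2) = 0"
    by (metis L2_norm_sq mult_zero_right add_0 order_antisym zero_le_power2 power_zero_numeral)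
  then have "AE x in lebesgue. (cmod (u x - v x))\<^sup>2 = 0"
    using L2_diff[OF uL vL] by (subst (asm) integral_nonneg_eq_0_iff_AE) (auto simp: L2_def)
  then show ?thesis by eventually_elim simp
qed

text \<open>By orthonormality every partial sum indexed by a set containing $m$ has the same inner product
  with $h_m$, and the inner product with $h_m$ is $L^2$-continuous by Cauchy--Schwarz.\<close>

lemma functional_calculus_coeff:
  assumes h: "\<And>m. h m \<in> L2" and on: "\<And>m n. L2_inner (h m) (h n) = (if m = n then 1 else 0)"
    and v: "functional_calculus E h \<phi> f v"
  shows "L2_inner v (h m) = complex_of_real (\<phi> (E m)) * L2_inner f (h m)"
proof -
  define S where "S A = (\<lambda>x. \<Sum>m\<in>A. complex_of_real (\<phi> (E m)) * L2_inner f (h m) * h m x)" for A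
  have S: "S A \<in> L2" if "finite A" for A
    unfolding S_def using that by (intro L2_sum L2_scale h) 
  have vL: "v \<in> L2" using v by (auto simp: functional_calculus_def)
  have vt: "((\<lambda>A. L2_norm (\<lambda>x. v x - S A x)) \<longlongrightarrow> 0) (finite_subsets_at_top UNIV)"
    using v by (auto simp: functional_calculus_def S_def)
  have bd: "cmod (L2_inner v (h m) - complex_of_real (\<phi> (E m)) * L2_inner f (h m))
      \<le> L2_norm (\<lambda>x. v x - S A x) * L2_norm (h m)" if A: "finite A" "{m} \<subseteq> A" for A
  proof -
    have "L2_inner (S A) (h m) = (\<Sum>k\<in>A. complex_of_real (\<phi> (E k)) * L2_inner f (h k) * L2_inner (h k) (h m))"
      unfolding S_def by (rule L2_inner_sum_left) (auto intro: h)
    also have "\<dots> = complex_of_real (\<phi> (E m)) * L2_inner f (h m)"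
      using A by (simp add: on if_distrib cong: if_cong) 
    finally show ?thesis
      using L2_Cauchy_Schwarz[OF L2_diff[OF vL S[OF A(1)]] h[of m]]
      by (simp add: L2_inner_diff_left[OF vL S[OF A(1)] h])
  qed
  have "cmod (L2_inner v (h m) - complex_of_real (\<phi> (E m)) * L2_inner f (h m)) \<le> 0 * L2_norm (h m)"
  proof (rule tendsto_lowerbound)
    show "((\<lambda>A. L2_norm (\<lambda>x. v x - S A x) * L2_norm (h m)) \<longlongrightarrow> 0 * L2_norm (h m))
        (finite_subsets_at_top UNIV)"
      by (intro tendsto_intros vt)
    show "eventually (\<lambda>A. cmod (L2_inner v (h m) - complex_of_real (\<phi> (E m)) * L2_inner f (h m))
      \<le> L2_norm (\<lambda>x. v x - S A x) * L2_norm (h m)) (finite_subsets_at_top UNIV)"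
      unfolding eventually_finite_subsets_at_top using bd by (intro exI[of _ "{m}"]) auto
  qed auto
  then show ?thesis by simp
qed

text \<open>The coefficients of $v = \varphi(H) f$ already carry the factors $\varphi(E_m)$, so the partial
  sums of $\psi(H) v$ and of $(\psi\varphi)(H) f$ coincide.\<close>

lemma functional_calculus_mult:
  assumes h: "\<And>m. h m \<in> L2" and on: "\<And>m n. L2_inner (h m) (h n) = (if m = n then 1 else 0)"
    and v: "functional_calculus E h \<phi> f v" and w: "functional_calculus E h \<psi> v w"
  shows "functional_calculus E h (\<lambda>e. \<psi> e * \<phi> e) f w"
  using w unfolding functional_calculus_def
  by (simp add: functional_calculus_coeff[OF h on v] mult.assoc)

section \<open>The semigroup inequality for the Green's function\<close>

lemma greens_function_regularity:
  assumes "greens_function T E h g" "t \<in> {0<..T}"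
  shows "(\<lambda>p. g (fst p) t (snd p)) \<in> borel_measurable (borel \<Otimes>\<^sub>M borel)"
    and "continuous_on UNIV (\<lambda>p. g (fst p) t (snd p))"
proof -
  have c: "continuous_on (UNIV \<times> {0<..T} \<times> UNIV) (\<lambda>(x, t, y). g x t y)"
    using assms(1) by (simp add: greens_function_def)
  have "continuous_on UNIV ((\<lambda>(x, t, y). g x t y) \<circ> (\<lambda>p. (fst p, t, snd p)))"
    using assms(2)
    by (intro continuous_on_compose continuous_intros continuous_on_subset[OF c]) auto
  then show "continuous_on UNIV (\<lambda>p. g (fst p) t (snd p))" by (simp add: o_def)
  then show "(\<lambda>p. g (fst p) t (snd p)) \<in> borel_measurable (borel \<Otimes>\<^sub>M borel)"
    by (simp add: borel_prod borel_measurable_continuous_onI)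
qed

lemma greens_function_measurable:
  assumes "greens_function T E h g" "t \<in> {0<..T}"
    and [measurable]: "u \<in> borel_measurable M" "v \<in> borel_measurable M"
  shows "(\<lambda>x. g (u x) t (v x)) \<in> borel_measurable M"
  using measurable_compose[OF measurable_Pair[OF assms(3,4)] greens_function_regularity(1)[OF assms(1,2)]]
  by simp

lemma AE_lebesgue_ball_ex:
  fixes x :: "'a :: euclidean_space"
  assumes "AE y in lebesgue. P y" "0 < r"
  shows "\<exists>y\<in>ball x r. P y"
proof (rule ccontr)
  assume no: "\<not> ?thesis"
  obtain N where N: "{y \<in> space lebesgue. \<not> P y} \<subseteq> N" "emeasure lebesgue N = 0" "N \<in> sets lebesgue"
    using assms(1) by (rule AE_E)
  have "negligible N" using N by (simp add: negligible_iff_null_sets null_setsI)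
  then have "negligible (ball x r)"
    by (rule negligible_subset) (use no N in auto)
  then show False using open_not_negligible[of "ball x r"] assms(2) by auto
qed

lemma indicator_ball_L2: "(\<lambda>y. indicator (ball a r) y) \<in> L2"
proof (rule L2_I)
  show "(\<lambda>y. indicator (ball a r) y :: complex) \<in> borel_measurable lebesgue"
    by (intro borel_measurable_indicator lmeasurable_ball fmeasurableD)
  have "integrable lebesgue (indicator (ball a r) :: _ \<Rightarrow> real)"
    using lmeasurable_ball[of a r] by (simp add: fmeasurable_def integrable_indicator_iff less_top)
  moreover have "(\<lambda>x. (cmod (indicator (ball a r) x))\<^sup>2) = (indicator (ball a r) :: _ \<Rightarrow> real)"
    by (auto simp: fun_eq_iff indicator_def)
  ultimately show "integrable lebesgue (\<lambda>x. (cmod (indicator (ball a r) x))\<^sup>2)" by simp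
qed

text \<open>The semigroup law $e^{-(s+t)H} f = e^{-sH} e^{-tH} f$, an identity in $L^2$ and therefore only
  almost everywhere in $x$.\<close>

lemma semigroup_AE:
  fixes g :: "real ^ 'd \<Rightarrow> real \<Rightarrow> real ^ 'd \<Rightarrow> real"
  assumes eig: "eigen_system V E h" and gr: "greens_function T E h g"
    and st: "0 < s" "0 < t" "s + t \<le> T" and f: "f \<in> L2"
  shows "AE x in lebesgue. (LINT y|lebesgue. complex_of_real (g x (s + t) y) * f y)
     = (LINT z|lebesgue. complex_of_real (g x s z) * (LINT y|lebesgue. complex_of_real (g z t y) * f y))"
proof -
  have h: "h m \<in> L2" for m
    using eig by (simp add: eigen_system_def schroedinger_op_def closed_form_domain_def)
  have on: "L2_inner (h m) (h n) = (if m = n then 1 else 0)" for m n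
    using eig by (simp add: eigen_system_def)
  have fc: "functional_calculus E h (\<lambda>e. exp (- r * e)) k
          (\<lambda>x. LINT y|lebesgue. complex_of_real (g x r y) * k y)" if "r \<in> {0<..T}" "k \<in> L2" for r k
    using gr that by (simp add: greens_function_def)
  let ?v = "\<lambda>z. LINT y|lebesgue. complex_of_real (g z t y) * f y"
  have v: "functional_calculus E h (\<lambda>e. exp (- t * e)) f ?v" by (rule fc) (use st f in auto)
  have vL: "?v \<in> L2" using v by (simp add: functional_calculus_def)
  have w: "functional_calculus E h (\<lambda>e. exp (- s * e)) ?v
       (\<lambda>x. LINT z|lebesgue. complex_of_real (g x s z) * ?v z)"
    by (rule fc) (use st vL in auto)
  have u: "functional_calculus E h (\<lambda>e. exp (- (s + t) * e)) f
       (\<lambda>x. LINT y|lebesgue. complex_of_real (g x (s + t) y) * f y)"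
    by (rule fc) (use st f in auto)
  have e: "(\<lambda>e::real. exp (- s * e) * exp (- t * e)) = (\<lambda>e. exp (- (s + t) * e))"
    by (simp add: exp_add[symmetric] algebra_simps)
  show ?thesis
    by (rule functional_calculus_unique[OF h u])
       (rule functional_calculus_mult[OF h on v w, unfolded e])
qed

text \<open>Testing the semigroup law on the indicator of a ball and applying Tonelli turns it into an
  identity between integrals of nonnegative kernels.\<close>

lemma semigroup_ball_AE:
  fixes g :: "real ^ 'd \<Rightarrow> real \<Rightarrow> real ^ 'd \<Rightarrow> real"
  assumes eig: "eigen_system V E h" and gr: "greens_function T E h g"
    and st: "0 < s" "0 < t" "s + t \<le> T"
  shows "AE x in lebesgue. 
     (\<integral>\<^sup>+ y\<in>ball a r. ennreal (g x (s + t) y) \<partial>lborel) < \<infinity> \<and>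
     (\<integral>\<^sup>+ y\<in>ball a r. ennreal (g x (s + t) y) \<partial>lborel)
     = (\<integral>\<^sup>+ y\<in>ball a r. (\<integral>\<^sup>+ z. ennreal (g x s z) * ennreal (g z t y) \<partial>lborel) \<partial>lborel)"
proof -
  define B where "B = ball a r"
  have [measurable]: "B \<in> sets borel" by (simp add: B_def)
  let ?f = "\<lambda>y. indicator B y :: complex"
  have f: "?f \<in> L2" unfolding B_def by (rule indicator_ball_L2)
  have pos: "0 < g x u y" if "u \<in> {0<..T}" for x u y using gr that by (simp add: greens_function_def)
  have s: "s \<in> {0<..T}" and t: "t \<in> {0<..T}" and stT: "s + t \<in> {0<..T}" using st by auto
  note km = greens_function_measurable[OF gr s] greens_function_measurable[OF gr t]
  have int: "AE x in lebesgue. integrable lebesgue (\<lambda>y. complex_of_real (g x u y) * k y)"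
    if "u \<in> {0<..T}" "k \<in> L2" for u k
    using gr that by (simp add: greens_function_def)
  have fc: "functional_calculus E h (\<lambda>e. exp (- r * e)) k
          (\<lambda>x. LINT y|lebesgue. complex_of_real (g x r y) * k y)" if "r \<in> {0<..T}" "k \<in> L2" for r k
    using gr that by (simp add: greens_function_def)
  define R where "R u x = (LINT y|lebesgue. g x u y * indicator B y)" for u x
  have Rc: "(LINT y|lebesgue. complex_of_real (g x u y) * ?f y) = complex_of_real (R u x)" for u x
  proof -
    have "(\<lambda>y. complex_of_real (g x u y) * ?f y) = (\<lambda>y. complex_of_real (g x u y * indicator B y))"
      by (auto simp: indicator_def)
    then show ?thesis unfolding R_def by (simp only: integral_complex_of_real)
  qed
  have R0: "0 \<le> R u x" if "u \<in> {0<..T}" for u x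
    unfolding R_def using pos[OF that] by (intro integral_nonneg_AE AE_I2) (auto simp: indicator_def less_imp_le)
  have Rn: "AE x in lebesgue. ennreal (R u x) = (\<integral>\<^sup>+ y\<in>B. ennreal (g x u y) \<partial>lborel)"
    if u: "u \<in> {0<..T}" for u
    using int[OF u f]
  proof eventually_elim
    case (elim x)
    have "integrable lebesgue (\<lambda>y. g x u y * indicator B y)"
    proof -
      have "(\<lambda>y. Re (complex_of_real (g x u y) * indicator B y)) = (\<lambda>y. g x u y * indicator B y)"
        by (auto simp: indicator_def)
      then show ?thesis using integrable_Re[OF elim] by simp
    qed
    then have "ennreal (R u x) = (\<integral>\<^sup>+ y. ennreal (g x u y * indicator B y) \<partial>lebesgue)"
      unfolding R_def using pos[OF u]
      by (subst nn_integral_eq_integral) (auto simp: indicator_def less_imp_le)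
    also have "\<dots> = (\<integral>\<^sup>+ y\<in>B. ennreal (g x u y) \<partial>lborel)"
      by (auto simp: nn_integral_completion indicator_def intro!: nn_integral_cong)
    finally show ?case .
  qed
  have vL: "(\<lambda>x. complex_of_real (R t x)) \<in> L2"
    using fc[OF t f] by (simp add: functional_calculus_def Rc)
  have "AE x in lebesgue. complex_of_real (R (s+t) x) 
      = (LINT z|lebesgue. complex_of_real (g x s z) * complex_of_real (R t z))"
    using semigroup_AE[OF eig gr st f] by (simp add: Rc)
  with int[OF s vL] Rn[OF stT] show ?thesis
    unfolding B_def[symmetric]
  proof eventually_elim
    case (elim x)
    have i: "integrable lebesgue (\<lambda>z. g x s z * R t z)"
      using integrable_Re[OF elim(1)] by simp
    have "complex_of_real (R (s+t) x) = complex_of_real (LINT z|lebesgue. g x s z * R t z)"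
      unfolding elim(3) of_real_mult[symmetric] by (rule integral_complex_of_real)
    then have "R (s+t) x = (LINT z|lebesgue. g x s z * R t z)" by (simp only: of_real_eq_iff)
    then have "ennreal (R (s+t) x) = (\<integral>\<^sup>+ z. ennreal (g x s z * R t z) \<partial>lebesgue)"
      using pos[OF s] R0[OF t] i by (subst nn_integral_eq_integral) (auto simp: less_imp_le)
    also have "\<dots> = (\<integral>\<^sup>+ z. ennreal (g x s z) * (\<integral>\<^sup>+ y\<in>B. ennreal (g z t y) \<partial>lborel) \<partial>lebesgue)"
      using Rn[OF t] by (intro nn_integral_cong_AE) (auto simp: ennreal_mult' pos[OF s] less_imp_le)
    also have "\<dots> = (\<integral>\<^sup>+ z. ennreal (g x s z) * (\<integral>\<^sup>+ y\<in>B. ennreal (g z t y) \<partial>lborel) \<partial>lborel)"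
      by (simp add: nn_integral_completion)
    also have "\<dots> = (\<integral>\<^sup>+ z. (\<integral>\<^sup>+ y. ennreal (g x s z) * ennreal (g z t y) * indicator B y \<partial>lborel) \<partial>lborel)"
      by (intro nn_integral_cong) (subst nn_integral_cmult[symmetric], auto simp: mult.assoc
          intro!: km borel_measurable_times_ennreal measurable_compose[OF _ measurable_ennreal] borel_measurable_indicator)
    also have "\<dots> = (\<integral>\<^sup>+ y. (\<integral>\<^sup>+ z. ennreal (g x s z) * ennreal (g z t y) * indicator B y \<partial>lborel) \<partial>lborel)"
    proof (rule lborel_pair.Fubini'[symmetric])
      show "(\<lambda>(z, y). ennreal (g x s z) * ennreal (g z t y) * indicator B y) \<in> borel_measurable (lborel \<Otimes>\<^sub>M lborel)"
        unfolding case_prod_unfold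
        by (intro borel_measurable_times_ennreal measurable_compose[OF km(1) measurable_ennreal]
            measurable_compose[OF km(2) measurable_ennreal]) simp_all
    qed
    also have "\<dots> = (\<integral>\<^sup>+ y\<in>B. (\<integral>\<^sup>+ z. ennreal (g x s z) * ennreal (g z t y) \<partial>lborel) \<partial>lborel)"
      by (intro nn_integral_cong) (auto simp: indicator_def)
    finally show ?case by (simp add: elim(2)[symmetric]) (metis ennreal_less_top)
  qed
qed

text \<open>The pointwise half of the Chapman--Kolmogorov equation. The exceptional null sets of the
  semigroup law are avoided as follows: near any $(x,y)$ there is a point at which the inequality
  holds, since otherwise the two kernels would have different integrals over a small ball. Along a
  sequence of such points tending to $(x,y)$, Fatou's lemma bounds the left-hand side from below and
  continuity of the Green's function gives the limit of the right-hand side.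

  Equality almost everywhere will come from a comparison of total masses, which also settles the
  diagonal $x = y$, a null set that an almost everywhere identity in
  $(x,y)$ would not see.\<close>

lemma sub_Chapman_Kolmogorov:
  fixes g :: "real ^ 'd \<Rightarrow> real \<Rightarrow> real ^ 'd \<Rightarrow> real"
  assumes eig: "eigen_system V E h" and gr: "greens_function T E h g"
    and st: "0 < s" "0 < t" "s + t \<le> T"
  shows "(\<integral>\<^sup>+ z. ennreal (g x s z) * ennreal (g z t y) \<partial>lborel) \<le> ennreal (g x (s + t) y)"
proof -
  define K where "K x y = (\<integral>\<^sup>+ z. ennreal (g x s z) * ennreal (g z t y) \<partial>lborel)" for x y
  have s: "s \<in> {0<..T}" and t: "t \<in> {0<..T}" and stT: "s + t \<in> {0<..T}" using st by auto
  note km = greens_function_measurable[OF gr s] greens_function_measurable[OF gr t] greens_function_measurable[OF gr stT]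
  have lim: "(\<lambda>n. ennreal (g (X n) u (Y n))) \<longlonglongrightarrow> ennreal (g x u y)"
    if u: "u \<in> {0<..T}" and X: "X \<longlonglongrightarrow> x" "Y \<longlonglongrightarrow> y" for X Y x y u
  proof -
    have "(\<lambda>n. (\<lambda>p. g (fst p) u (snd p)) (X n, Y n)) \<longlonglongrightarrow> (\<lambda>p. g (fst p) u (snd p)) (x, y)"
      by (rule continuous_on_tendsto_compose[OF greens_function_regularity(2)[OF gr u]])
         (auto intro!: tendsto_Pair X)
    then show ?thesis by (intro tendsto_ennrealI) simp
  qed
  have "\<exists>p. fst p \<in> ball x r \<and> snd p \<in> ball y r \<and> K (fst p) (snd p) \<le> ennreal (g (fst p) (s+t) (snd p))"
    if r: "0 < r" for r
  proof -
    obtain x' where x': "x' \<in> ball x r"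
      and fin: "(\<integral>\<^sup>+ y'\<in>ball y r. ennreal (g x' (s + t) y') \<partial>lborel) < \<infinity>"
      and eq: "(\<integral>\<^sup>+ y'\<in>ball y r. ennreal (g x' (s + t) y') \<partial>lborel) = (\<integral>\<^sup>+ y'\<in>ball y r. K x' y' \<partial>lborel)"
      using AE_lebesgue_ball_ex[OF semigroup_ball_AE[OF eig gr st, of y r] r, of x] unfolding K_def by blast
    have "\<exists>y'\<in>ball y r. K x' y' \<le> ennreal (g x' (s+t) y')"
    proof (rule ccontr)
      assume "\<not> ?thesis"
      then have gt: "ennreal (g x' (s+t) y') < K x' y'" if "y' \<in> ball y r" for y' using that by (auto simp: not_le)
      have 1: "(\<lambda>y'. g x' (s + t) y') \<in> borel_measurable borel"
        by (rule km) auto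
      have 2: "(\<lambda>y'. K x' y') \<in> borel_measurable borel"
      proof -
        show ?thesis unfolding K_def
          by (rule lborel.borel_measurable_nn_integral)
            (unfold case_prod_unfold, intro borel_measurable_times_ennreal
             measurable_compose[OF km(1) measurable_ennreal] measurable_compose[OF km(2) measurable_ennreal], simp_all)
      qed
      have "(\<integral>\<^sup>+ y'\<in>ball y r. ennreal (g x' (s + t) y') \<partial>lborel) < (\<integral>\<^sup>+ y'\<in>ball y r. K x' y' \<partial>lborel)"
      proof (rule nn_integral_less)
        show "\<not> (AE y' in lborel. K x' y' * indicator (ball y r) y' \<le> ennreal (g x' (s+t) y') * indicator (ball y r) y')"
        proof
          assume "AE y' in lborel. K x' y' * indicator (ball y r) y' \<le> ennreal (g x' (s+t) y') * indicator (ball y r) y'"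
          then have "AE y' in lebesgue. K x' y' * indicator (ball y r) y' \<le> ennreal (g x' (s+t) y') * indicator (ball y r) y'"
            by (rule AE_completion)
          from AE_lebesgue_ball_ex[OF this r, of y] obtain y' where "y' \<in> ball y r"
            "K x' y' * indicator (ball y r) y' \<le> ennreal (g x' (s+t) y') * indicator (ball y r) y'"
            by blast
          with gt[of y'] show False by simp
        qed
      qed (use 1 2 fin gt in \<open>auto simp: indicator_def less_imp_le\<close>)
      then show False using eq by simp
    qed
    then obtain y' where "y' \<in> ball y r" "K x' y' \<le> ennreal (g x' (s+t) y')" by blast
    with x' show ?thesis by (intro exI[of _ "(x', y')"]) simp
  qed
  then have "\<forall>n. \<exists>p. fst p \<in> ball x (inverse (real (Suc n))) \<and> snd p \<in> ball y (inverse (real (Suc n))) \<and>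
      K (fst p) (snd p) \<le> ennreal (g (fst p) (s+t) (snd p))" by simp
  from choice[OF this] obtain p where p:
    "\<And>n. fst (p n) \<in> ball x (inverse (real (Suc n)))" "\<And>n. snd (p n) \<in> ball y (inverse (real (Suc n)))"
    "\<And>n. K (fst (p n)) (snd (p n)) \<le> ennreal (g (fst (p n)) (s+t) (snd (p n)))"
    by blast
  have X: "(\<lambda>n. fst (p n)) \<longlonglongrightarrow> x"
  proof (rule metric_tendsto_imp_tendsto[OF LIMSEQ_inverse_real_of_nat])
    have "dist (fst (p n)) x \<le> dist (inverse (real (Suc n))) 0" for n
      using p(1)[of n] by (simp add: dist_commute less_imp_le del: of_nat_Suc)
    then show "eventually (\<lambda>n. dist (fst (p n)) x \<le> dist (inverse (real (Suc n))) 0) sequentially" by simp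
  qed
  have Y: "(\<lambda>n. snd (p n)) \<longlonglongrightarrow> y"
  proof (rule metric_tendsto_imp_tendsto[OF LIMSEQ_inverse_real_of_nat])
    have "dist (snd (p n)) y \<le> dist (inverse (real (Suc n))) 0" for n
      using p(2)[of n] by (simp add: dist_commute less_imp_le del: of_nat_Suc)
    then show "eventually (\<lambda>n. dist (snd (p n)) y \<le> dist (inverse (real (Suc n))) 0) sequentially" by simp
  qed
  have "K x y = (\<integral>\<^sup>+ z. liminf (\<lambda>n. ennreal (g (fst (p n)) s z) * ennreal (g z t (snd (p n)))) \<partial>lborel)"
    unfolding K_def
    by (intro nn_integral_cong lim_imp_Liminf[symmetric] tendsto_mult_ennreal lim s t X Y tendsto_const) auto
  also have "\<dots> \<le> liminf (\<lambda>n. K (fst (p n)) (snd (p n)))"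
    unfolding K_def
  proof (rule nn_integral_liminf)
    fix n
    show "(\<lambda>z. ennreal (g (fst (p n)) s z) * ennreal (g z t (snd (p n)))) \<in> borel_measurable lborel"
      by (intro borel_measurable_times_ennreal measurable_compose[OF km(1) measurable_ennreal]
          measurable_compose[OF km(2) measurable_ennreal]) simp_all
  qed
  also have "\<dots> \<le> liminf (\<lambda>n. ennreal (g (fst (p n)) (s+t) (snd (p n))))"
    by (intro Liminf_mono always_eventually allI p(3))
  also have "\<dots> = ennreal (g x (s + t) y)"
    by (intro lim_imp_Liminf lim stT X Y) auto
  finally show ?thesis unfolding K_def .
qed

section \<open>Integration over finite powers of Lebesgue measure\<close>

text \<open>The nonnegative difference $g - f$ has integral zero, so $f = g$ almost everywhere. This is how the inequality between kernels becomes an equality between laws.\<close>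

lemma nn_set_integral_eq_of_total:
  assumes [measurable]: "f \<in> borel_measurable M" "g \<in> borel_measurable M"
    and le: "\<And>x. x \<in> space M \<Longrightarrow> f x \<le> g x"
    and eq: "(\<integral>\<^sup>+ x. f x \<partial>M) = (\<integral>\<^sup>+ x. g x \<partial>M)" and fin: "(\<integral>\<^sup>+ x. f x \<partial>M) \<noteq> \<infinity>"
  shows "(\<integral>\<^sup>+ x\<in>A. f x \<partial>M) = (\<integral>\<^sup>+ x\<in>A. g x \<partial>M)"
proof -
  have "AE x in M. g x \<le> f x"
  proof (rule ccontr)
    assume "\<not> ?thesis"
    then have "(\<integral>\<^sup>+ x. f x \<partial>M) < (\<integral>\<^sup>+ x. g x \<partial>M)"
      by (intro nn_integral_less fin) (use le in auto)
    with eq show False by simp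
  qed
  then have "AE x in M. f x = g x"
    using AE_space by eventually_elim (use le in \<open>auto intro: antisym\<close>)
  then show ?thesis by (intro nn_integral_cong_AE) auto
qed

lemma lborel_product_sigma_finite: "product_sigma_finite (\<lambda>_. lborel :: 'a::euclidean_space measure)"
  by unfold_locales

lemma sigma_finite_PiM_lborel: 
  "finite I \<Longrightarrow> sigma_finite_measure (PiM I (\<lambda>_. lborel :: 'a::euclidean_space measure))"
  using product_sigma_finite.sigma_finite[OF lborel_product_sigma_finite] .

lemma nn_integral_PiM_lborel_insert:
  fixes f :: "('i \<Rightarrow> 'a::euclidean_space) \<Rightarrow> ennreal"
  assumes I: "finite I" "i \<notin> I" and f: "f \<in> borel_measurable (PiM (insert i I) (\<lambda>_. lborel))"
    and F: "\<And>k. k \<in> insert i I \<Longrightarrow> F k \<in> sets borel"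
  shows "(\<integral>\<^sup>+ y\<in>Pi\<^sub>E (insert i I) F. f y \<partial>PiM (insert i I) (\<lambda>_. lborel))
    = (\<integral>\<^sup>+ x\<in>F i. (\<integral>\<^sup>+ y\<in>Pi\<^sub>E I F. f (y(i := x)) \<partial>PiM I (\<lambda>_. lborel)) \<partial>lborel)"
proof -
  have [measurable]: "Pi\<^sub>E (insert i I) F \<in> sets (PiM (insert i I) (\<lambda>_. lborel))" "Pi\<^sub>E I F \<in> sets (PiM I (\<lambda>_. lborel))"
    using I F by (auto intro!: sets_PiM_I_finite)
  have "(\<integral>\<^sup>+ y\<in>Pi\<^sub>E (insert i I) F. f y \<partial>PiM (insert i I) (\<lambda>_. lborel)) =
     (\<integral>\<^sup>+ x. (\<integral>\<^sup>+ y. f (y(i := x)) * indicator (Pi\<^sub>E (insert i I) F) (y(i := x)) \<partial>PiM I (\<lambda>_. lborel)) \<partial>lborel)"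
    using f by (intro product_sigma_finite.product_nn_integral_insert_rev[OF lborel_product_sigma_finite I]) simp
  also have "\<dots> = (\<integral>\<^sup>+ x\<in>F i. (\<integral>\<^sup>+ y\<in>Pi\<^sub>E I F. f (y(i := x)) \<partial>PiM I (\<lambda>_. lborel)) \<partial>lborel)"
  proof (rule nn_integral_cong)
    fix x :: 'a
    have "(\<integral>\<^sup>+ y. f (y(i := x)) * indicator (Pi\<^sub>E (insert i I) F) (y(i := x)) \<partial>PiM I (\<lambda>_. lborel))
      = (\<integral>\<^sup>+ y. f (y(i := x)) * indicator (Pi\<^sub>E I F) y * indicator (F i) x \<partial>PiM I (\<lambda>_. lborel))"
    proof (rule nn_integral_cong)
      fix y assume "y \<in> space (PiM I (\<lambda>_. lborel :: 'a measure))"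
      then have "y \<in> extensional I" by (auto simp: space_PiM PiE_def)
      then have "y(i := x) \<in> Pi\<^sub>E (insert i I) F \<longleftrightarrow> y \<in> Pi\<^sub>E I F \<and> x \<in> F i"
        using I(2) by (auto simp: PiE_iff extensional_def)
      then show "f (y(i := x)) * indicator (Pi\<^sub>E (insert i I) F) (y(i := x))
          = f (y(i := x)) * indicator (Pi\<^sub>E I F) y * indicator (F i) x"
        by (auto simp: indicator_def)
    qed
    also have "\<dots> = (\<integral>\<^sup>+ y\<in>Pi\<^sub>E I F. f (y(i := x)) \<partial>PiM I (\<lambda>_. lborel)) * indicator (F i) x"
      by (cases "x \<in> F i") auto
    finally show "(\<integral>\<^sup>+ y. f (y(i := x)) * indicator (Pi\<^sub>E (insert i I) F) (y(i := x)) \<partial>PiM I (\<lambda>_. lborel))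
      = (\<integral>\<^sup>+ y\<in>Pi\<^sub>E I F. f (y(i := x)) \<partial>PiM I (\<lambda>_. lborel)) * indicator (F i) x" .
  qed
  finally show ?thesis .
qed

lemma nn_integral_PiM_lborel_singleton:
  fixes f :: "'a::euclidean_space \<Rightarrow> ennreal"
  assumes "f \<in> borel_measurable borel" "F i \<in> sets borel"
  shows "(\<integral>\<^sup>+ y\<in>Pi\<^sub>E {i} F. f (y i) \<partial>PiM {i} (\<lambda>_. lborel)) = (\<integral>\<^sup>+ x\<in>F i. f x \<partial>lborel)"
proof -
  have "(\<integral>\<^sup>+ y\<in>Pi\<^sub>E {i} F. f (y i) \<partial>PiM {i} (\<lambda>_. lborel)) 
     = (\<integral>\<^sup>+ y. f (y i) * indicator (F i) (y i) \<partial>PiM {i} (\<lambda>_. lborel))"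
    by (rule nn_integral_cong) (auto simp: indicator_def space_PiM PiE_iff)
  also have "\<dots> = (\<integral>\<^sup>+ x. f x * indicator (F i) x \<partial>lborel)"
    using assms by (intro product_sigma_finite.product_nn_integral_singleton[OF lborel_product_sigma_finite]) simp
  finally show ?thesis .
qed

text \<open>Relabelling coordinates from $\{1,\dots,m\}$ to $\{2,\dots,m+1\}$ makes room for a new first
  point of the path.\<close>

lemma nn_integral_PiM_lborel_shift:
  fixes f :: "(nat \<Rightarrow> 'a::euclidean_space) \<Rightarrow> ennreal"
  assumes f: "f \<in> borel_measurable (PiM {2..Suc m} (\<lambda>_. lborel))"
    and F: "\<And>k. k \<in> {2..Suc m} \<Longrightarrow> F k \<in> sets borel"
  shows "(\<integral>\<^sup>+ y\<in>Pi\<^sub>E {2..Suc m} F. f y \<partial>PiM {2..Suc m} (\<lambda>_. lborel))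
    = (\<integral>\<^sup>+ y\<in>Pi\<^sub>E {1..m} (\<lambda>k. F (Suc k)). f (\<lambda>k\<in>{2..Suc m}. y (k - 1)) \<partial>PiM {1..m} (\<lambda>_. lborel))"
proof -
  let ?L = "\<lambda>_. lborel :: 'a measure"
  let ?s = "\<lambda>y::nat \<Rightarrow> 'a. \<lambda>k\<in>{2..Suc m}. y (k - 1)"
  interpret P: product_sigma_finite ?L by (rule lborel_product_sigma_finite)
  interpret A: finite_product_sigma_finite ?L "{1..m}" by standard auto
  have s: "?s \<in> PiM {1..m} ?L \<rightarrow>\<^sub>M PiM {2..Suc m} ?L"
    by (intro measurable_restrict measurable_component_singleton) auto
  have mem: "?s y \<in> Pi\<^sub>E {2..Suc m} B \<longleftrightarrow> y \<in> Pi\<^sub>E {1..m} (\<lambda>k. B (Suc k))" if "y \<in> space (PiM {1..m} ?L)" for y B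
  proof -
    have e: "{2..Suc m} = Suc ` {1..m}" by (simp add: numeral_2_eq_2)
    have "(\<forall>k\<in>{2..Suc m}. y (k - 1) \<in> B k) \<longleftrightarrow> (\<forall>k\<in>{1..m}. y k \<in> B (Suc k))"
      unfolding e by (simp del: image_Suc_atLeastAtMost)
    then show ?thesis using that by (auto simp: PiE_iff space_PiM)
  qed
  have D: "distr (PiM {1..m} ?L) (PiM {2..Suc m} ?L) ?s = PiM {2..Suc m} ?L"
  proof (rule P.PiM_eqI)
    fix B assume B: "\<And>i. i \<in> {2..Suc m} \<Longrightarrow> B i \<in> sets (lborel :: 'a measure)"
    have "?s -` Pi\<^sub>E {2..Suc m} B \<inter> space (PiM {1..m} ?L) = Pi\<^sub>E {1..m} (\<lambda>k. B (Suc k))"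
    proof -
      have "Pi\<^sub>E {1..m} (\<lambda>k. B (Suc k)) \<subseteq> space (PiM {1..m} ?L)" by (auto simp: space_PiM PiE_iff)
      then show ?thesis using mem[of _ B] by blast
    qed
    moreover have "Pi\<^sub>E {2..Suc m} B \<in> sets (PiM {2..Suc m} ?L)"
      using B by (intro sets_PiM_I_finite) auto
    ultimately have "emeasure (distr (PiM {1..m} ?L) (PiM {2..Suc m} ?L) ?s) (Pi\<^sub>E {2..Suc m} B)
       = emeasure (PiM {1..m} ?L) (Pi\<^sub>E {1..m} (\<lambda>k. B (Suc k)))"
      by (simp only: emeasure_distr[OF s])
    also have "\<dots> = (\<Prod>i\<in>{1..m}. emeasure lborel (B (Suc i)))"
      using B by (intro A.measure_times) auto
    also have "\<dots> = (\<Prod>i\<in>{2..Suc m}. emeasure lborel (B i))"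
      by (simp add: numeral_2_eq_2 prod.shift_bounds_cl_Suc_ivl del: prod.cl_ivl_Suc)
    finally show "emeasure (distr (PiM {1..m} ?L) (PiM {2..Suc m} ?L) ?s) (Pi\<^sub>E {2..Suc m} B)
       = (\<Prod>i\<in>{2..Suc m}. emeasure lborel (B i))" .
  qed auto
  have "(\<integral>\<^sup>+ y\<in>Pi\<^sub>E {2..Suc m} F. f y \<partial>PiM {2..Suc m} ?L)
     = (\<integral>\<^sup>+ y\<in>Pi\<^sub>E {2..Suc m} F. f y \<partial>distr (PiM {1..m} ?L) (PiM {2..Suc m} ?L) ?s)"
    by (simp only: D)
  also have "\<dots> = (\<integral>\<^sup>+ y. f (?s y) * indicator (Pi\<^sub>E {2..Suc m} F) (?s y) \<partial>PiM {1..m} ?L)"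
    using f F by (intro nn_integral_distr s borel_measurable_times_ennreal borel_measurable_indicator sets_PiM_I_finite) auto
  also have "\<dots> = (\<integral>\<^sup>+ y\<in>Pi\<^sub>E {1..m} (\<lambda>k. F (Suc k)). f (?s y) \<partial>PiM {1..m} ?L)"
    by (rule nn_integral_cong) (simp only: mem indicator_def)
  finally show ?thesis .
qed

section \<open>Increasing times and loop densities\<close>

definition chain_density ::
  "('a \<Rightarrow> real \<Rightarrow> 'a \<Rightarrow> real) \<Rightarrow> nat \<Rightarrow> (nat \<Rightarrow> real) \<Rightarrow> (nat \<Rightarrow> 'a) \<Rightarrow> real" where
  "chain_density g n t y = (\<Prod>k=2..n. g (y k) (t k - t (k - 1)) (y (k - 1)))"

text \<open>The cyclic product of kernels around a loop of total duration $T$ that visits $y_1,\dots,y_n$ at the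
  times $t_1 < \dots < t_n$; the last factor is the step from $y_n$ through the end of the interval
  back to $y_1$.\<close>

definition loop_density ::
  "('a \<Rightarrow> real \<Rightarrow> 'a \<Rightarrow> real) \<Rightarrow> real \<Rightarrow> nat \<Rightarrow> (nat \<Rightarrow> real) \<Rightarrow> (nat \<Rightarrow> 'a) \<Rightarrow> real" where
  "loop_density g T n t y = chain_density g n t y * g (y 1) (T - (t n - t 1)) (y n)"

definition increasing_times :: "real \<Rightarrow> nat \<Rightarrow> (nat \<Rightarrow> real) \<Rightarrow> bool" where
  "increasing_times T n t \<longleftrightarrow> 1 \<le> n \<and> 0 \<le> t 1 \<and> t n \<le> T \<and> (\<forall>k\<in>{2..n}. t (k - 1) < t k)"

lemma increasing_times_less:
  assumes "increasing_times T n t" "1 \<le> i" "i < j" "j \<le> n"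
  shows "t i < t j"
  using assms(3,4)
proof (induction j)
  case (Suc j)
  have "\<forall>k\<in>{2..n}. t (k - 1) < t k" using assms(1) by (simp add: increasing_times_def)
  from bspec[OF this, of "Suc j"] have "t j < t (Suc j)" using assms(2) Suc.prems by simp
  with Suc show ?case by (cases "i = j") auto
qed simp

lemma increasing_times_bounds:
  assumes "increasing_times T n t" "1 \<le> k" "k \<le> n"
  shows "t 1 \<le> t k" "t k \<le> t n" "0 \<le> t k" "t k \<le> T"
proof -
  show "t 1 \<le> t k" using increasing_times_less[OF assms(1), of 1 k] assms by (cases "k = 1") auto
  moreover show "t k \<le> t n" using increasing_times_less[OF assms(1), of k n] assms by (cases "k = n") auto
  ultimately show "0 \<le> t k" "t k \<le> T" using assms(1) by (auto simp: increasing_times_def)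
qed

lemma increasing_times_gap:
  assumes "increasing_times T n t" "k \<in> {2..n}"
  shows "t k - t (k - 1) \<in> {0<..T}"
proof -
  have "t (k - 1) < t k" using assms by (auto simp: increasing_times_def)
  moreover have "0 \<le> t (k - 1)" "t k \<le> T"
    using increasing_times_bounds[OF assms(1), of k] increasing_times_bounds[OF assms(1), of "k - 1"] assms(2)
    by auto
  ultimately show ?thesis by simp
qed

section \<open>The finite-dimensional distributions of the loop\<close>

lemma ennreal_cancel_scale:
  assumes "0 < c" "ennreal c * a = 1" "ennreal c * b = 1"
  shows "a = b" "a \<noteq> \<infinity>"
proof -
  have "ennreal c * a = ennreal c * b" using assms by simp
  then show "a = b" using assms(1) by (subst (asm) ennreal_mult_cancel_left) auto
  show "a \<noteq> \<infinity>" using assms(1,2) by (auto simp: ennreal_mult_top)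
qed

text \<open>The probabilistic core: a kernel that satisfies half of the Chapman--Kolmogorov equation and has a
  trace, and a process whose law, conditioned on the common end point $x$, is that of the bridge from
  $x$ to $x$, with $x$ distributed according to $c\,g(x,T,x)\,dx$. The bridge formula speaks of
  interior times and of the two end points; the cyclic formula is derived from it.\<close>

locale loop_process = prob_space M
  for M :: "'w measure" +
  fixes g :: "'a::euclidean_space \<Rightarrow> real \<Rightarrow> 'a \<Rightarrow> real" and T c :: real and Z :: "real \<Rightarrow> 'w \<Rightarrow> 'a"
  assumes T_pos: "0 < T" and c_pos: "0 < c"
    and kernel_pair_measurable: "t \<in> {0<..T} \<Longrightarrow> (\<lambda>p. g (fst p) t (snd p)) \<in> borel_measurable (borel \<Otimes>\<^sub>M borel)"
    and kernel_pos: "t \<in> {0<..T} \<Longrightarrow> 0 < g x t y"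
    and sub_ck: "0 < s \<Longrightarrow> 0 < t \<Longrightarrow> s + t \<le> T \<Longrightarrow>
      (\<integral>\<^sup>+ z. ennreal (g x s z) * ennreal (g z t y) \<partial>lborel) \<le> ennreal (g x (s + t) y)"
    and trace: "ennreal c * (\<integral>\<^sup>+ x. ennreal (g x T x) \<partial>lborel) = 1"
    and Z_measurable: "\<tau> \<in> {0..T} \<Longrightarrow> Z \<tau> \<in> borel_measurable M"
    and bridge_law: "increasing_times T n ts \<Longrightarrow> 0 < ts 1 \<Longrightarrow> ts n < T \<Longrightarrow>
      A \<in> sets borel \<Longrightarrow> B \<in> sets borel \<Longrightarrow> (\<And>k. k \<in> {1..n} \<Longrightarrow> F k \<in> sets borel) \<Longrightarrow>
      emeasure M {\<omega> \<in> space M. Z 0 \<omega> \<in> A \<and> (\<forall>k\<in>{1..n}. Z (ts k) \<omega> \<in> F k) \<and> Z T \<omega> \<in> B}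
      = ennreal c * (\<integral>\<^sup>+ x\<in>A \<inter> B. (\<integral>\<^sup>+ y\<in>Pi\<^sub>E {1..n} F.
          ennreal (chain_density g n ts y * (g (y 1) (ts 1) x * g x (T - ts n) (y n))) \<partial>PiM {1..n} (\<lambda>_. lborel)) \<partial>lborel)"
begin

lemma kernel_measurable:
  "t \<in> {0<..T} \<Longrightarrow> u \<in> borel_measurable N \<Longrightarrow> v \<in> borel_measurable N \<Longrightarrow> (\<lambda>x. g (u x) t (v x)) \<in> borel_measurable N"
  using measurable_compose[OF measurable_Pair kernel_pair_measurable, of u N v t] by simp

lemma chain_density_nonneg:
  assumes "increasing_times T n t" shows "0 \<le> chain_density g n t y"
  unfolding chain_density_def
proof (rule prod_nonneg)
  fix k assume k: "k \<in> {2..n}"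
  then have "t k - t (k - 1) \<in> {0<..T}" by (rule increasing_times_gap[OF assms])
  then show "0 \<le> g (y k) (t k - t (k - 1)) (y (k - 1))" by (rule less_imp_le[OF kernel_pos])
qed

lemma chain_density_measurable:
  assumes "increasing_times T n t" "\<And>k. k \<in> {1..n} \<Longrightarrow> (\<lambda>x. y x k) \<in> borel_measurable N"
  shows "(\<lambda>x. chain_density g n t (y x)) \<in> borel_measurable N"
  unfolding chain_density_def
proof (rule borel_measurable_prod)
  fix k assume k: "k \<in> {2..n}"
  then have "t k - t (k - 1) \<in> {0<..T}" by (rule increasing_times_gap[OF assms(1)])
  then show "(\<lambda>x. g (y x k) (t k - t (k - 1)) (y x (k - 1))) \<in> borel_measurable N"
    using k by (intro kernel_measurable assms) auto
qed

lemma loop_density_measurable: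
  assumes t: "increasing_times T n t" and gap: "t n - t 1 < T" and I: "{1..n} \<subseteq> I"
  shows "loop_density g T n t \<in> borel_measurable (PiM I (\<lambda>_. lborel))"
proof -
  have "1 \<in> I" "n \<in> I" using t I by (auto simp: increasing_times_def)
  have c: "(\<lambda>x. x k) \<in> borel_measurable (PiM I (\<lambda>_. lborel :: 'a measure))" if "k \<in> I" for k
    using measurable_component_singleton[OF that, of "\<lambda>_. lborel :: 'a measure"] by simp
  have gapi: "T - (t n - t 1) \<in> {0<..T}"
    using gap increasing_times_bounds[OF t, of n] t by (auto simp: increasing_times_def)
  have "(\<lambda>y. loop_density g T n t y) \<in> borel_measurable (PiM I (\<lambda>_. lborel))"
    unfolding loop_density_def
    by (intro borel_measurable_times chain_density_measurable t kernel_measurable gapi c) 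
      (use I \<open>1 \<in> I\<close> \<open>n \<in> I\<close> in auto)
  then show ?thesis .
qed

text \<open>At the last time $T$ the path returns to its starting point, so the starting point of the bridge
  formula is the coordinate $x_n$ of the loop density.\<close>

lemma loop_law_ending_at_T:
  assumes t: "increasing_times T n t" and gap: "t n - t 1 < T" and n: "2 \<le> n" and T: "t n = T"
    and F: "\<And>k. k \<in> {1..n} \<Longrightarrow> F k \<in> sets borel"
  shows "emeasure M {\<omega> \<in> space M. \<forall>k\<in>{1..n}. Z (t k) \<omega> \<in> F k}
    = ennreal c * (\<integral>\<^sup>+ y\<in>Pi\<^sub>E {1..n} F. ennreal (loop_density g T n t y) \<partial>PiM {1..n} (\<lambda>_. lborel))"
proof -
  obtain m where nm: "n = Suc m" and m: "1 \<le> m" using n by (cases n) auto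
  have ins: "{1..n} = insert n {1..m}" using nm by auto
  have mem: "n \<notin> {1..m}" using nm by auto
  have tm: "t m < T" using increasing_times_less[OF t, of m n] nm m T by auto
  have "{\<omega> \<in> space M. \<forall>k\<in>{1..n}. Z (t k) \<omega> \<in> F k}
     = {\<omega> \<in> space M. Z 0 \<omega> \<in> UNIV \<and> (\<forall>k\<in>{1..m}. Z (t k) \<omega> \<in> F k) \<and> Z T \<omega> \<in> F n}"
    unfolding ins using T by auto
  then have "emeasure M {\<omega> \<in> space M. \<forall>k\<in>{1..n}. Z (t k) \<omega> \<in> F k}
     = ennreal c * (\<integral>\<^sup>+ x\<in>UNIV \<inter> F n. (\<integral>\<^sup>+ y\<in>Pi\<^sub>E {1..m} F.
          ennreal (chain_density g m t y * (g (y 1) (t 1) x * g x (T - t m) (y m))) \<partial>PiM {1..m} (\<lambda>_. lborel)) \<partial>lborel)"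
    using t gap T tm m nm F by (simp only:, intro bridge_law) (auto simp: increasing_times_def)
  also have "(\<integral>\<^sup>+ x\<in>UNIV \<inter> F n. (\<integral>\<^sup>+ y\<in>Pi\<^sub>E {1..m} F.
          ennreal (chain_density g m t y * (g (y 1) (t 1) x * g x (T - t m) (y m))) \<partial>PiM {1..m} (\<lambda>_. lborel)) \<partial>lborel)
     = (\<integral>\<^sup>+ x\<in>F n. (\<integral>\<^sup>+ y\<in>Pi\<^sub>E {1..m} F. ennreal (loop_density g T n t (y(n := x))) \<partial>PiM {1..m} (\<lambda>_. lborel)) \<partial>lborel)"
  proof -
    have "chain_density g n t (y(n := x)) = chain_density g m t y * g x (T - t m) (y m)" for x y
    proof -
      have "chain_density g n t (y(n := x)) = chain_density g m t (y(n := x)) * g x (T - t m) (y m)"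
        using n nm T by (simp add: chain_density_def mult.commute)
      also have "chain_density g m t (y(n := x)) = chain_density g m t y"
        unfolding chain_density_def using nm by (intro prod.cong) auto
      finally show ?thesis .
    qed
    then have "loop_density g T n t (y(n := x)) = chain_density g m t y * (g (y 1) (t 1) x * g x (T - t m) (y m))" for x y
      using n T by (simp add: loop_density_def mult_ac)
    then show ?thesis by simp
  qed
  also have "\<dots> = (\<integral>\<^sup>+ y\<in>Pi\<^sub>E {1..n} F. ennreal (loop_density g T n t y) \<partial>PiM {1..n} (\<lambda>_. lborel))"
    unfolding ins
  proof (rule nn_integral_PiM_lborel_insert[symmetric])
    show "(\<lambda>y. ennreal (loop_density g T n t y)) \<in> borel_measurable (PiM (insert n {1..m}) (\<lambda>_. lborel))"
      using loop_density_measurable[OF t gap, of "{1..n}"] ins by simp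
  qed (use F mem ins in auto)
  finally show ?thesis .
qed

text \<open>Here the starting point of the bridge formula is the coordinate $x_1$, and the times of the
  bridge formula are $t_2,\dots,t_n$.\<close>

lemma loop_law_starting_at_0:
  assumes t: "increasing_times T n t" and gap: "t n - t 1 < T" and n: "2 \<le> n" and t1: "t 1 = 0"
    and F: "\<And>k. k \<in> {1..n} \<Longrightarrow> F k \<in> sets borel"
  shows "emeasure M {\<omega> \<in> space M. \<forall>k\<in>{1..n}. Z (t k) \<omega> \<in> F k}
    = ennreal c * (\<integral>\<^sup>+ y\<in>Pi\<^sub>E {1..n} F. ennreal (loop_density g T n t y) \<partial>PiM {1..n} (\<lambda>_. lborel))"
proof -
  obtain m where nm: "n = Suc m" and m: "1 \<le> m" using n by (cases n) auto
  have ins: "{1..n} = insert 1 {2..Suc m}" using nm by auto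
  have ins': "{1..n} = insert 1 (Suc ` {1..m})" using nm by auto
  let ?t = "\<lambda>k. t (Suc k)" and ?F = "\<lambda>k. F (Suc k)"
  have t2: "0 < t 2" using increasing_times_less[OF t, of 1 2] n t1 by auto
  have tn: "t n < T" using gap t1 by simp
  have "{\<omega> \<in> space M. \<forall>k\<in>{1..n}. Z (t k) \<omega> \<in> F k}
     = {\<omega> \<in> space M. Z 0 \<omega> \<in> F 1 \<and> (\<forall>k\<in>{1..m}. Z (?t k) \<omega> \<in> ?F k) \<and> Z T \<omega> \<in> UNIV}"
    unfolding ins' using t1 by (auto simp del: image_Suc_atLeastAtMost)
  then have "emeasure M {\<omega> \<in> space M. \<forall>k\<in>{1..n}. Z (t k) \<omega> \<in> F k}
     = ennreal c * (\<integral>\<^sup>+ x\<in>F 1 \<inter> UNIV. (\<integral>\<^sup>+ y\<in>Pi\<^sub>E {1..m} ?F.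
          ennreal (chain_density g m ?t y * (g (y 1) (?t 1) x * g x (T - ?t m) (y m))) \<partial>PiM {1..m} (\<lambda>_. lborel)) \<partial>lborel)"
  proof (simp only:, intro bridge_law)
    have "?t (k - 1) < ?t k" if "k \<in> {2..m}" for k
      using increasing_times_less[OF t, of k "Suc k"] that nm by auto
    then show "increasing_times T m ?t"
      using m t2 tn nm by (auto simp: increasing_times_def numeral_2_eq_2)
  qed (use t2 tn nm F in \<open>auto simp: numeral_2_eq_2\<close>)
  also have "(\<integral>\<^sup>+ x\<in>F 1 \<inter> UNIV. (\<integral>\<^sup>+ y\<in>Pi\<^sub>E {1..m} ?F.
          ennreal (chain_density g m ?t y * (g (y 1) (?t 1) x * g x (T - ?t m) (y m))) \<partial>PiM {1..m} (\<lambda>_. lborel)) \<partial>lborel)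
     = (\<integral>\<^sup>+ x\<in>F 1. (\<integral>\<^sup>+ y\<in>Pi\<^sub>E {1..m} ?F. 
          ennreal (loop_density g T n t ((\<lambda>k\<in>{2..Suc m}. y (k - 1))(1 := x))) \<partial>PiM {1..m} (\<lambda>_. lborel)) \<partial>lborel)"
  proof -
    have "loop_density g T n t ((\<lambda>k\<in>{2..Suc m}. y (k - 1))(1 := x))
       = chain_density g m ?t y * (g (y 1) (?t 1) x * g x (T - ?t m) (y m))" for x y
    proof -
      let ?w = "(\<lambda>k\<in>{2..Suc m}. y (k - 1))(1 := x)"
      have "chain_density g n t ?w = g (?w 2) (t 2 - t (2 - 1)) (?w (2 - 1)) * (\<Prod>k=Suc 2..Suc m. g (?w k) (t k - t (k - 1)) (?w (k - 1)))"
        unfolding chain_density_def nm using m by (intro prod.atLeast_Suc_atMost) auto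
      also have "(\<Prod>k=Suc 2..Suc m. g (?w k) (t k - t (k - 1)) (?w (k - 1)))
         = (\<Prod>k=2..m. g (?w (Suc k)) (t (Suc k) - t (Suc k - 1)) (?w (Suc k - 1)))"
        by (rule prod.shift_bounds_cl_Suc_ivl)
      also have "\<dots> = chain_density g m ?t y"
        unfolding chain_density_def by (intro prod.cong) auto
      also have "g (?w 2) (t 2 - t (2 - 1)) (?w (2 - 1)) = g (y 1) (?t 1) x"
        using m t1 by (simp add: numeral_2_eq_2)
      finally have ch: "chain_density g n t ?w = g (y 1) (?t 1) x * chain_density g m ?t y" .
      have w1: "?w 1 = x" and wn: "?w n = y m" using nm m by auto
      show ?thesis
        unfolding loop_density_def ch w1 wn using nm t1 by (simp add: mult_ac)
    qed
    then show ?thesis by simp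
  qed
  also have "\<dots> = (\<integral>\<^sup>+ x\<in>F 1. (\<integral>\<^sup>+ y\<in>Pi\<^sub>E {2..Suc m} F. ennreal (loop_density g T n t (y(1 := x))) \<partial>PiM {2..Suc m} (\<lambda>_. lborel)) \<partial>lborel)"
  proof (intro nn_integral_cong arg_cong2[where f="(*)"] refl nn_integral_PiM_lborel_shift[symmetric])
    fix x :: 'a
    have "(\<lambda>y. y(1 := x)) \<in> PiM {2..Suc m} (\<lambda>_. lborel) \<rightarrow>\<^sub>M PiM {1..n} (\<lambda>_. lborel)"
      unfolding ins by (rule measurable_fun_upd[where J="{2..Suc m}"]) auto
    from measurable_compose[OF this loop_density_measurable[OF t gap order_refl]]
    show "(\<lambda>y. ennreal (loop_density g T n t (y(1 := x)))) \<in> borel_measurable (PiM {2..Suc m} (\<lambda>_. lborel))"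
      by simp
  qed (use F nm in auto)
  also have "\<dots> = (\<integral>\<^sup>+ y\<in>Pi\<^sub>E {1..n} F. ennreal (loop_density g T n t y) \<partial>PiM {1..n} (\<lambda>_. lborel))"
    unfolding ins
  proof (rule nn_integral_PiM_lborel_insert[symmetric])
    show "(\<lambda>y. ennreal (loop_density g T n t y)) \<in> borel_measurable (PiM (insert 1 {2..Suc m}) (\<lambda>_. lborel))"
      using loop_density_measurable[OF t gap, of "{1..n}"] ins by simp
  qed (use F nm in auto)
  finally show ?thesis .
qed

lemma three_point_law:
  assumes s: "0 < s" "s < T" and A: "A \<in> sets borel" and B: "B \<in> sets borel" and C: "C \<in> sets borel"
  shows "emeasure M {\<omega> \<in> space M. Z 0 \<omega> \<in> A \<and> Z s \<omega> \<in> B \<and> Z T \<omega> \<in> C}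
    = ennreal c * (\<integral>\<^sup>+ x\<in>A \<inter> C. (\<integral>\<^sup>+ z\<in>B. ennreal (g x (T - s) z) * ennreal (g z s x) \<partial>lborel) \<partial>lborel)"
proof -
  have h1: "s \<in> {0<..T}" and h2: "T - s \<in> {0<..T}" using s by auto
  have "emeasure M {\<omega> \<in> space M. Z 0 \<omega> \<in> A \<and> Z s \<omega> \<in> B \<and> Z T \<omega> \<in> C}
    = emeasure M {\<omega> \<in> space M. Z 0 \<omega> \<in> A \<and> (\<forall>k\<in>{1..1::nat}. Z ((\<lambda>_. s) k) \<omega> \<in> (\<lambda>_. B) k) \<and> Z T \<omega> \<in> C}"
    by simp
  also have "\<dots> = ennreal c * (\<integral>\<^sup>+ x\<in>A \<inter> C. (\<integral>\<^sup>+ y\<in>Pi\<^sub>E {1..1::nat} (\<lambda>_. B).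
        ennreal (chain_density g 1 (\<lambda>_. s) y * (g (y 1) s x * g x (T - s) (y 1))) \<partial>PiM {1..1} (\<lambda>_. lborel)) \<partial>lborel)"
    by (rule bridge_law) (use s A B C in \<open>auto simp: increasing_times_def\<close>)
  also have "(\<lambda>x. \<integral>\<^sup>+ y\<in>Pi\<^sub>E {1..1::nat} (\<lambda>_. B).
        ennreal (chain_density g 1 (\<lambda>_. s) y * (g (y 1) s x * g x (T - s) (y 1))) \<partial>PiM {1..1} (\<lambda>_. lborel))
      = (\<lambda>x. \<integral>\<^sup>+ z\<in>B. ennreal (g x (T - s) z) * ennreal (g z s x) \<partial>lborel)"
  proof
    fix x
    have "(\<integral>\<^sup>+ y\<in>Pi\<^sub>E {1..1::nat} (\<lambda>_. B).
        ennreal (chain_density g 1 (\<lambda>_. s) y * (g (y 1) s x * g x (T - s) (y 1))) \<partial>PiM {1..1} (\<lambda>_. lborel))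
      = (\<integral>\<^sup>+ y\<in>Pi\<^sub>E {1::nat} (\<lambda>_. B).
        (\<lambda>z. ennreal (g x (T - s) z) * ennreal (g z s x)) (y 1) \<partial>PiM {1} (\<lambda>_. lborel))"
      by (simp add: chain_density_def ennreal_mult[symmetric] kernel_pos[OF h1] kernel_pos[OF h2] less_imp_le mult.commute)
    also have "\<dots> = (\<integral>\<^sup>+ z\<in>B. ennreal (g x (T - s) z) * ennreal (g z s x) \<partial>lborel)"
      by (rule nn_integral_PiM_lborel_singleton)
         (auto intro!: B borel_measurable_times_ennreal measurable_compose[OF kernel_measurable[OF h1] measurable_ennreal]
            measurable_compose[OF kernel_measurable[OF h2] measurable_ennreal])
    finally show "(\<integral>\<^sup>+ y\<in>Pi\<^sub>E {1..1::nat} (\<lambda>_. B).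
        ennreal (chain_density g 1 (\<lambda>_. s) y * (g (y 1) s x * g x (T - s) (y 1))) \<partial>PiM {1..1} (\<lambda>_. lborel))
      = (\<integral>\<^sup>+ z\<in>B. ennreal (g x (T - s) z) * ennreal (g z s x) \<partial>lborel)" .
  qed
  finally show ?thesis .
qed

text \<open>The bridge formula with one intermediate time $T/2$, integrated out. The intermediate integral
  is at most $g(x,T,x)$, and both functions of $x$ have integral $1/c$. Choosing disjoint sets
  shows that the path is closed.\<close>

lemma loop_law_two_ends:
  assumes F: "F0 \<in> sets borel" "FT \<in> sets borel"
  shows "emeasure M {\<omega> \<in> space M. Z 0 \<omega> \<in> F0 \<and> Z T \<omega> \<in> FT}
    = ennreal c * (\<integral>\<^sup>+ x\<in>F0 \<inter> FT. ennreal (g x T x) \<partial>lborel)"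
proof -
  let ?K = "\<lambda>x. \<integral>\<^sup>+ z. ennreal (g x (T/2) z) * ennreal (g z (T/2) x) \<partial>lborel"
  have h: "T/2 \<in> {0<..T}" and TT: "T \<in> {0<..T}" using T_pos by auto
  have law: "emeasure M {\<omega> \<in> space M. Z 0 \<omega> \<in> A \<and> Z T \<omega> \<in> B} = ennreal c * (\<integral>\<^sup>+ x\<in>A \<inter> B. ?K x \<partial>lborel)"
    if "A \<in> sets borel" "B \<in> sets borel" for A B
    using three_point_law[of "T/2" A UNIV B] T_pos that by simp
  have m: "?K \<in> borel_measurable lborel" 
    by (rule lborel.borel_measurable_nn_integral)
       (unfold case_prod_unfold, intro borel_measurable_times_ennreal
        measurable_compose[OF kernel_measurable[OF h] measurable_ennreal], simp_all)
  have m': "(\<lambda>x. ennreal (g x T x)) \<in> borel_measurable lborel"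
    by (intro measurable_compose[OF kernel_measurable[OF TT] measurable_ennreal]) simp_all
  have K1: "ennreal c * (\<integral>\<^sup>+ x. ?K x \<partial>lborel) = 1"
    using law[of UNIV UNIV] emeasure_space_1 by simp
  have "(\<integral>\<^sup>+ x\<in>F0 \<inter> FT. ?K x \<partial>lborel) = (\<integral>\<^sup>+ x\<in>F0 \<inter> FT. ennreal (g x T x) \<partial>lborel)"
  proof (rule nn_set_integral_eq_of_total[OF m m'])
    show "?K x \<le> ennreal (g x T x)" for x using sub_ck[of "T/2" "T/2" x x] T_pos by simp
    show "(\<integral>\<^sup>+ x. ?K x \<partial>lborel) = (\<integral>\<^sup>+ x. ennreal (g x T x) \<partial>lborel)"
      by (rule ennreal_cancel_scale(1)[OF c_pos K1 trace])
    show "(\<integral>\<^sup>+ x. ?K x \<partial>lborel) \<noteq> \<infinity>"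
      by (rule ennreal_cancel_scale(2)[OF c_pos K1 K1])
  qed
  with law[OF F] show ?thesis by simp
qed

text \<open>The loop density depends on the differences of the times only, so the times may be moved until
  the last one is $T$. There the loop density is known to be the density of a probability. A single
  time leaves only the trace condition.\<close>

lemma loop_density_total:
  assumes t: "increasing_times T n t" and gap: "t n - t 1 < T"
  shows "ennreal c * (\<integral>\<^sup>+ y. ennreal (loop_density g T n t y) \<partial>PiM {1..n} (\<lambda>_. lborel)) = 1"
proof (cases "n = 1")
  case True
  have TT: "T \<in> {0<..T}" using T_pos by auto
  have "(\<integral>\<^sup>+ y. ennreal (loop_density g T n t y) \<partial>PiM {1..n} (\<lambda>_. lborel)) =
    (\<integral>\<^sup>+ y. (\<lambda>x. ennreal (g x T x)) (y 1) \<partial>PiM {1::nat} (\<lambda>_. lborel))"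
    using True by (simp add: loop_density_def chain_density_def)
  also have "\<dots> = (\<integral>\<^sup>+ x. ennreal (g x T x) \<partial>lborel)"
    by (rule product_sigma_finite.product_nn_integral_singleton[OF lborel_product_sigma_finite])
       (intro measurable_compose[OF kernel_measurable[OF TT] measurable_ennreal], simp_all)
  finally show ?thesis using trace by simp
next
  case False
  then have n: "2 \<le> n" using t by (auto simp: increasing_times_def)
  \<comment> \<open>the first time becomes $T - (t_n - t_1) > 0$\<close>
  let ?t = "\<lambda>k. t k + (T - t n)"
  have "increasing_times T n ?t" using t by (auto simp: increasing_times_def)
  then have "emeasure M {\<omega> \<in> space M. \<forall>k\<in>{1..n}. Z (?t k) \<omega> \<in> UNIV}
    = ennreal c * (\<integral>\<^sup>+ y\<in>Pi\<^sub>E {1..n} (\<lambda>_. UNIV). ennreal (loop_density g T n ?t y) \<partial>PiM {1..n} (\<lambda>_. lborel))"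
    by (rule loop_law_ending_at_T[where F="\<lambda>_. UNIV"]) (use gap n in auto)
  also have "loop_density g T n ?t = loop_density g T n t"
    by (simp add: fun_eq_iff loop_density_def chain_density_def)
  also have "(\<integral>\<^sup>+ y\<in>Pi\<^sub>E {1..n} (\<lambda>_. UNIV). ennreal (loop_density g T n t y) \<partial>PiM {1..n} (\<lambda>_. lborel))
     = (\<integral>\<^sup>+ y. ennreal (loop_density g T n t y) \<partial>PiM {1..n} (\<lambda>_. lborel))"
    by (rule nn_integral_cong) (auto simp: indicator_def space_PiM PiE_iff)
  finally show ?thesis using emeasure_space_1 by simp
qed

text \<open>Integrating the starting point $x$ out of the bridge formula joins the last step to the first one
  through $\int g(x_1,t_1,x)\,g(x,T-t_n,x_n)\,dx \le g(x_1,T-(t_n-t_1),x_n)$. The resulting density is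
  bounded by the loop density and both have total mass one, hence they agree almost everywhere.\<close>

lemma loop_law_interior:
  assumes t: "increasing_times T n t" and t1: "0 < t 1" and tn: "t n < T"
    and F: "\<And>k. k \<in> {1..n} \<Longrightarrow> F k \<in> sets borel"
  shows "emeasure M {\<omega> \<in> space M. \<forall>k\<in>{1..n}. Z (t k) \<omega> \<in> F k}
    = ennreal c * (\<integral>\<^sup>+ y\<in>Pi\<^sub>E {1..n} F. ennreal (loop_density g T n t y) \<partial>PiM {1..n} (\<lambda>_. lborel))"
proof -
  let ?P = "PiM {1..n} (\<lambda>_. lborel :: 'a measure)"
  interpret P: sigma_finite_measure ?P by (rule sigma_finite_PiM_lborel) simp
  interpret pair_sigma_finite lborel ?P ..
  have n: "1 \<in> {1..n}" "n \<in> {1..n}" "1 \<le> n" using t by (auto simp: increasing_times_def)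
  have le: "t 1 \<le> t n" using increasing_times_bounds[OF t, of n] n by auto
  have h1: "t 1 \<in> {0<..T}" and h2: "T - t n \<in> {0<..T}" using t1 tn le by auto
  have gap: "t n - t 1 < T" using t1 tn by simp
  define k where "k x y = ennreal (chain_density g n t y * (g (y 1) (t 1) x * g x (T - t n) (y n)))" for x y
  have km: "(\<lambda>p. k (fst p) (snd p)) \<in> borel_measurable (lborel \<Otimes>\<^sub>M ?P)"
  proof -
    have c: "(\<lambda>p. snd p i) \<in> borel_measurable ((lborel :: 'a measure) \<Otimes>\<^sub>M ?P)" if "i \<in> {1..n}" for i
      using measurable_compose[OF measurable_snd[of "lborel :: 'a measure"]
          measurable_component_singleton[OF that, of "\<lambda>_. lborel :: 'a measure"]] by simp
    show ?thesis unfolding k_def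
      by (intro measurable_compose[OF _ measurable_ennreal] borel_measurable_times chain_density_measurable t
          kernel_measurable h1 h2 c n) simp_all
  qed
  define K where "K y = (\<integral>\<^sup>+ x. k x y \<partial>lborel)" for y
  have Km: "K \<in> borel_measurable ?P" unfolding K_def
    by (rule lborel.borel_measurable_nn_integral)
       (use measurable_compose[OF measurable_pair_swap' km] in \<open>simp add: case_prod_unfold\<close>)
  have Lm: "(\<lambda>y. ennreal (loop_density g T n t y)) \<in> borel_measurable ?P"
    using loop_density_measurable[OF t gap order_refl] by simp
  have law: "emeasure M {\<omega> \<in> space M. \<forall>k\<in>{1..n}. Z (t k) \<omega> \<in> A k}
    = ennreal c * (\<integral>\<^sup>+ y\<in>Pi\<^sub>E {1..n} A. K y \<partial>?P)" if A: "\<And>k. k \<in> {1..n} \<Longrightarrow> A k \<in> sets borel" for A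
  proof -
    have S: "Pi\<^sub>E {1..n} A \<in> sets ?P" using A by (intro sets_PiM_I_finite) auto
    have "emeasure M {\<omega> \<in> space M. \<forall>k\<in>{1..n}. Z (t k) \<omega> \<in> A k}
      = emeasure M {\<omega> \<in> space M. Z 0 \<omega> \<in> UNIV \<and> (\<forall>k\<in>{1..n}. Z (t k) \<omega> \<in> A k) \<and> Z T \<omega> \<in> UNIV}"
      by simp
    also have "\<dots> = ennreal c * (\<integral>\<^sup>+ x\<in>UNIV \<inter> UNIV. (\<integral>\<^sup>+ y\<in>Pi\<^sub>E {1..n} A. k x y \<partial>?P) \<partial>lborel)"
      unfolding k_def by (rule bridge_law) (use t t1 tn A in \<open>auto simp: increasing_times_def\<close>)
    also have "(\<integral>\<^sup>+ x\<in>UNIV \<inter> UNIV. (\<integral>\<^sup>+ y\<in>Pi\<^sub>E {1..n} A. k x y \<partial>?P) \<partial>lborel)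
      = (\<integral>\<^sup>+ y. (\<integral>\<^sup>+ x. k x y * indicator (Pi\<^sub>E {1..n} A) y \<partial>lborel) \<partial>?P)"
    proof -
      have "(\<lambda>p. k (fst p) (snd p) * indicator (Pi\<^sub>E {1..n} A) (snd p)) \<in> borel_measurable (lborel \<Otimes>\<^sub>M ?P)"
        by (intro borel_measurable_times_ennreal km measurable_compose[OF measurable_snd borel_measurable_indicator[OF S]])
      then have "(\<lambda>(x, y). k x y * indicator (Pi\<^sub>E {1..n} A) y) \<in> borel_measurable (lborel \<Otimes>\<^sub>M ?P)"
        by (simp only: case_prod_unfold)
      from Fubini'[OF this] show ?thesis by simp
    qed
    also have "\<dots> = (\<integral>\<^sup>+ y\<in>Pi\<^sub>E {1..n} A. K y \<partial>?P)"
      unfolding K_def by (rule nn_integral_cong) (auto simp: indicator_def)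
    finally show ?thesis .
  qed
  have KL: "K y \<le> ennreal (loop_density g T n t y)" for y
  proof -
    have "K y = (\<integral>\<^sup>+ x. ennreal (chain_density g n t y) * (ennreal (g (y 1) (t 1) x) * ennreal (g x (T - t n) (y n))) \<partial>lborel)"
      unfolding K_def k_def
      using chain_density_nonneg[OF t] kernel_pos[OF h1] kernel_pos[OF h2]
      by (simp add: ennreal_mult less_imp_le)
    also have "\<dots> = ennreal (chain_density g n t y) * (\<integral>\<^sup>+ x. ennreal (g (y 1) (t 1) x) * ennreal (g x (T - t n) (y n)) \<partial>lborel)"
      by (intro nn_integral_cmult borel_measurable_times_ennreal measurable_compose[OF kernel_measurable[OF h1] measurable_ennreal]
            measurable_compose[OF kernel_measurable[OF h2] measurable_ennreal]) simp_all
    also have "\<dots> \<le> ennreal (chain_density g n t y) * ennreal (g (y 1) (t 1 + (T - t n)) (y n))"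
      by (intro mult_left_mono sub_ck) (use t1 tn le in auto)
    also have "\<dots> = ennreal (loop_density g T n t y)"
      unfolding loop_density_def
      using chain_density_nonneg[OF t] by (simp add: ennreal_mult' algebra_simps)
    finally show ?thesis .
  qed
  have U: "(\<integral>\<^sup>+ y\<in>Pi\<^sub>E {1..n} (\<lambda>_. UNIV). K y \<partial>?P) = (\<integral>\<^sup>+ y. K y \<partial>?P)"
    by (rule nn_integral_cong) (auto simp: indicator_def space_PiM PiE_iff)
  have K1: "ennreal c * (\<integral>\<^sup>+ y. K y \<partial>?P) = 1"
    using law[of "\<lambda>_. UNIV"] emeasure_space_1 U by simp
  have "(\<integral>\<^sup>+ y\<in>Pi\<^sub>E {1..n} F. K y \<partial>?P) = (\<integral>\<^sup>+ y\<in>Pi\<^sub>E {1..n} F. ennreal (loop_density g T n t y) \<partial>?P)"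
  proof (rule nn_set_integral_eq_of_total[OF Km Lm KL])
    show "(\<integral>\<^sup>+ y. K y \<partial>?P) = (\<integral>\<^sup>+ y. ennreal (loop_density g T n t y) \<partial>?P)"
      by (rule ennreal_cancel_scale(1)[OF c_pos K1 loop_density_total[OF t gap]])
    show "(\<integral>\<^sup>+ y. K y \<partial>?P) \<noteq> \<infinity>"
      by (rule ennreal_cancel_scale(2)[OF c_pos K1 K1])
  qed
  with law[OF F] show ?thesis by simp
qed

text \<open>Times that contain both $0$ and $T$ would put two coordinates at the same point of the loop, and
  their joint law has no density; hence the bound on the gap. A single time $0$ or $T$ is a marginal
  of the law of the two end points, and all other times are covered by the three cases above.\<close>

lemma loop_law:
  assumes t: "increasing_times T n t" and gap: "t n - t 1 < T"
    and F: "\<And>k. k \<in> {1..n} \<Longrightarrow> F k \<in> sets borel"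
  shows "emeasure M {\<omega> \<in> space M. \<forall>k\<in>{1..n}. Z (t k) \<omega> \<in> F k}
    = ennreal c * (\<integral>\<^sup>+ y\<in>Pi\<^sub>E {1..n} F. ennreal (loop_density g T n t y) \<partial>PiM {1..n} (\<lambda>_. lborel))"
proof -
  have n: "1 \<le> n" "0 \<le> t 1" "t n \<le> T" using t by (auto simp: increasing_times_def)
  consider "0 < t 1" "t n < T" | "n = 1" "t 1 = 0 \<or> t 1 = T" | "2 \<le> n" "t n = T" | "2 \<le> n" "t 1 = 0"
    using n by (cases "n = 1") fastforce+
  then show ?thesis
  proof cases
    case 2
    have TT: "T \<in> {0<..T}" using T_pos by auto
    have F1: "F 1 \<in> sets borel" using F[of 1] n by simp
    have "emeasure M {\<omega> \<in> space M. \<forall>k\<in>{1..n}. Z (t k) \<omega> \<in> F k} = ennreal c * (\<integral>\<^sup>+ x\<in>F 1. ennreal (g x T x) \<partial>lborel)"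
      using 2 loop_law_two_ends[OF F1, of UNIV] loop_law_two_ends[of UNIV, OF _ F1] by auto
    also have "(\<integral>\<^sup>+ x\<in>F 1. ennreal (g x T x) \<partial>lborel)
       = (\<integral>\<^sup>+ y\<in>Pi\<^sub>E {1::nat} F. (\<lambda>x. ennreal (g x T x)) (y 1) \<partial>PiM {1} (\<lambda>_. lborel))"
      by (rule nn_integral_PiM_lborel_singleton[symmetric])
         (intro measurable_compose[OF kernel_measurable[OF TT] measurable_ennreal] F1, simp_all add: F1[simplified])
    finally show ?thesis using 2 by (simp add: loop_density_def chain_density_def)
  qed (use loop_law_interior[OF t _ _ F] loop_law_ending_at_T[OF t gap _ _ F] loop_law_starting_at_0[OF t gap _ _ F] in auto)
qed

section \<open>One-time laws, stationarity and positivity\<close>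

lemma one_time_law:
  assumes t: "t \<in> {0..T}" and F: "F \<in> sets borel"
  shows "emeasure M {\<omega> \<in> space M. Z t \<omega> \<in> F} = ennreal c * (\<integral>\<^sup>+ x\<in>F. ennreal (g x T x) \<partial>lborel)"
proof -
  have TT: "T \<in> {0<..T}" using T_pos by auto
  have "emeasure M {\<omega> \<in> space M. Z t \<omega> \<in> F} = emeasure M {\<omega> \<in> space M. \<forall>k\<in>{1..1::nat}. Z ((\<lambda>_. t) k) \<omega> \<in> (\<lambda>_. F) k}"
    by simp
  also have "\<dots> = ennreal c * (\<integral>\<^sup>+ y\<in>Pi\<^sub>E {1..1} (\<lambda>_. F). ennreal (loop_density g T 1 (\<lambda>_. t) y) \<partial>PiM {1..1} (\<lambda>_. lborel))"
    by (rule loop_law) (use t F T_pos in \<open>auto simp: increasing_times_def\<close>)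
  also have "(\<integral>\<^sup>+ y\<in>Pi\<^sub>E {1..1::nat} (\<lambda>_. F). ennreal (loop_density g T 1 (\<lambda>_. t) y) \<partial>PiM {1..1} (\<lambda>_. lborel))
     = (\<integral>\<^sup>+ y\<in>Pi\<^sub>E {1::nat} (\<lambda>_. F). (\<lambda>x. ennreal (g x T x)) (y 1) \<partial>PiM {1} (\<lambda>_. lborel))"
    by (simp add: loop_density_def chain_density_def)
  also have "\<dots> = (\<integral>\<^sup>+ x\<in>F. ennreal (g x T x) \<partial>lborel)"
    by (rule nn_integral_PiM_lborel_singleton)
       (intro measurable_compose[OF kernel_measurable[OF TT] measurable_ennreal] F, simp_all add: F)
  finally show ?thesis .
qed

lemma distr_one_time:
  assumes t: "t \<in> {0..T}"
  shows "distr M borel (Z t) = density lborel (\<lambda>x. ennreal (c * g x T x))"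
proof (rule measure_eqI)
  have TT: "T \<in> {0<..T}" using T_pos by auto
  have m: "(\<lambda>x. g x T x) \<in> borel_measurable lborel" by (rule kernel_measurable[OF TT]) simp_all
  fix F assume "F \<in> sets (distr M borel (Z t))"
  then have F: "F \<in> sets borel" by simp
  have "emeasure (distr M borel (Z t)) F = emeasure M {\<omega> \<in> space M. Z t \<omega> \<in> F}"
    using F Z_measurable[OF t] by (simp add: emeasure_distr vimage_def Int_def conj_commute)
  also have "\<dots> = ennreal c * (\<integral>\<^sup>+ x\<in>F. ennreal (g x T x) \<partial>lborel)" by (rule one_time_law[OF t F])
  also have "\<dots> = (\<integral>\<^sup>+ x\<in>F. ennreal (c * g x T x) \<partial>lborel)"
    using F m c_pos kernel_pos[OF TT]
    by (subst nn_integral_cmult[symmetric]) (auto simp: ennreal_mult less_imp_le mult.assoc)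
  also have "\<dots> = emeasure (density lborel (\<lambda>x. ennreal (c * g x T x))) F"
    using F m by (subst emeasure_density) auto
  finally show "emeasure (distr M borel (Z t)) F = emeasure (density lborel (\<lambda>x. ennreal (c * g x T x))) F" .
qed simp

lemma expectation_one_time:
  fixes b :: "'a \<Rightarrow> complex"
  assumes t: "t \<in> {0..T}" and b: "b \<in> borel_measurable borel" "bounded (range b)"
  shows "integrable lborel (\<lambda>x. b x * complex_of_real (g x T x))"
    and "(LINT \<omega>|M. b (Z t \<omega>)) = complex_of_real c * (LINT x|lborel. b x * complex_of_real (g x T x))"
proof -
  have TT: "T \<in> {0<..T}" using T_pos by auto
  have m: "(\<lambda>x. g x T x) \<in> borel_measurable lborel" by (rule kernel_measurable[OF TT]) simp_all
  then have m': "(\<lambda>x. c * g x T x) \<in> borel_measurable lborel" by simp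
  have bl: "b \<in> borel_measurable lborel" using b by simp
  have nn: "0 \<le> c * g x T x" for x using c_pos kernel_pos[OF TT, of x x] by simp
  obtain C where C: "\<And>x. cmod (b x) \<le> C" using b(2) by (auto simp: bounded_iff)
  have "integrable M (\<lambda>\<omega>. b (Z t \<omega>))"
    by (rule integrable_const_bound[of _ C]) (use C measurable_compose[OF Z_measurable[OF t] b(1)] in auto)
  then have "integrable (distr M borel (Z t)) b"
    by (subst integrable_distr_eq) (use Z_measurable[OF t] b in auto)
  then have "integrable lborel (\<lambda>x. (c * g x T x) *\<^sub>R b x)"
    unfolding distr_one_time[OF t]
    by (subst (asm) integrable_density[OF bl m' AE_I2[OF nn]])
  then have "integrable lborel (\<lambda>x. inverse c *\<^sub>R ((c * g x T x) *\<^sub>R b x))"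
    by (rule integrable_scaleR_right)
  moreover have "(\<lambda>x. inverse c *\<^sub>R ((c * g x T x) *\<^sub>R b x)) = (\<lambda>x. b x * complex_of_real (g x T x))"
    using c_pos by (auto simp: fun_eq_iff scaleR_conv_of_real)
  ultimately show "integrable lborel (\<lambda>x. b x * complex_of_real (g x T x))" by simp
  have "(LINT \<omega>|M. b (Z t \<omega>)) = (LINT x|distr M borel (Z t). b x)"
    by (rule integral_distr[symmetric]) (use Z_measurable[OF t] b in auto)
  also have "\<dots> = (LINT x|lborel. (c * g x T x) *\<^sub>R b x)"
    unfolding distr_one_time[OF t] by (rule integral_density[OF bl m' AE_I2[OF nn]])
  also have "\<dots> = (LINT x|lborel. complex_of_real c * (b x * complex_of_real (g x T x)))"
    by (simp add: scaleR_conv_of_real mult_ac)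
  also have "\<dots> = complex_of_real c * (LINT x|lborel. b x * complex_of_real (g x T x))"
    by (rule integral_mult_right_zero)
  finally show "(LINT \<omega>|M. b (Z t \<omega>)) = complex_of_real c * (LINT x|lborel. b x * complex_of_real (g x T x))" .
qed

text \<open>The times, listed increasingly, give the same loop density before and after translation. A
  nonzero translation within $[0,T]$ excludes that both $0$ and $T$ occur, which is the case not
  covered by the cyclic formula.\<close>

lemma rectangle_shift:
  assumes S: "finite S" "S \<subseteq> {0..T}" and sh: "\<And>s. s \<in> S \<Longrightarrow> s + \<tau> \<in> {0..T}"
    and F: "\<And>s. s \<in> S \<Longrightarrow> F s \<in> sets borel"
  shows "emeasure M {\<omega> \<in> space M. \<forall>s\<in>S. Z (s + \<tau>) \<omega> \<in> F s} = emeasure M {\<omega> \<in> space M. \<forall>s\<in>S. Z s \<omega> \<in> F s}"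
proof (cases "S = {} \<or> \<tau> = 0")
  case False
  define l where "l = sorted_list_of_set S"
  define n where "n = length l"
  define u where "u k = l ! (k - 1)" for k
  have l: "set l = S" "sorted l" "distinct l" using S by (auto simp: l_def)
  have n: "1 \<le> n" using False l(1) unfolding n_def by (cases l) auto
  have im: "S = u ` {1..n}"
  proof -
    have "S = (\<lambda>i. l ! i) ` {..<n}" using l(1) by (auto simp: set_conv_nth n_def)
    also have "{..<n} = (\<lambda>k. k - 1) ` {1..n}"
      using n by (force simp: image_iff)
    finally show ?thesis by (simp add: image_image u_def)
  qed
  have less: "u (k - 1) < u k" if "k \<in> {2..n}" for k
    using strict_sorted_list_of_set[of S] that unfolding u_def n_def l_def[symmetric]
    by (auto intro!: sorted_wrt_nth_less[of "(<)" l])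
  have uS: "u k \<in> S" if "k \<in> {1..n}" for k using im that by blast
  have u1: "u 1 \<in> S" and un: "u n \<in> S" using uS n by auto
  have inc: "increasing_times T n u" "increasing_times T n (\<lambda>k. u k + \<tau>)"
    using n less u1 un S(2) sh[OF u1] sh[OF un] by (auto simp: increasing_times_def)
  have gap: "u n - u 1 < T"
    using False u1 un S(2) sh[OF u1] sh[OF un] by (cases "0 < \<tau>") force+
  have FU: "F (u k) \<in> sets borel" if "k \<in> {1..n}" for k using F uS[OF that] by blast
  have "emeasure M {\<omega> \<in> space M. \<forall>k\<in>{1..n}. Z (u k + \<tau>) \<omega> \<in> F (u k)}
     = ennreal c * (\<integral>\<^sup>+ y\<in>Pi\<^sub>E {1..n} (\<lambda>k. F (u k)). ennreal (loop_density g T n (\<lambda>k. u k + \<tau>) y) \<partial>PiM {1..n} (\<lambda>_. lborel))"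
    by (rule loop_law[OF inc(2)]) (use gap FU in auto)
  also have "loop_density g T n (\<lambda>k. u k + \<tau>) = loop_density g T n u"
    by (simp add: fun_eq_iff loop_density_def chain_density_def)
  also have "ennreal c * (\<integral>\<^sup>+ y\<in>Pi\<^sub>E {1..n} (\<lambda>k. F (u k)). ennreal (loop_density g T n u y) \<partial>PiM {1..n} (\<lambda>_. lborel))
     = emeasure M {\<omega> \<in> space M. \<forall>k\<in>{1..n}. Z (u k) \<omega> \<in> F (u k)}"
    by (rule loop_law[OF inc(1) gap FU, symmetric])
  finally show ?thesis unfolding im by simp
qed auto

lemma joint_law_shift:
  assumes S: "finite S" "S \<subseteq> {0..T}" and sh: "\<And>s. s \<in> S \<Longrightarrow> s + \<tau> \<in> {0..T}"
  shows "distr M (PiM S (\<lambda>_. borel)) (\<lambda>\<omega>. \<lambda>s\<in>S. Z (s + \<tau>) \<omega>) = distr M (PiM S (\<lambda>_. borel)) (\<lambda>\<omega>. \<lambda>s\<in>S. Z s \<omega>)"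
proof (rule measure_eqI_PiM_finite)
  have m1: "(\<lambda>\<omega>. \<lambda>s\<in>S. Z (s + \<tau>) \<omega>) \<in> M \<rightarrow>\<^sub>M PiM S (\<lambda>_. borel)"
    using sh by (intro measurable_restrict Z_measurable) auto
  have m2: "(\<lambda>\<omega>. \<lambda>s\<in>S. Z s \<omega>) \<in> M \<rightarrow>\<^sub>M PiM S (\<lambda>_. borel)"
    using S by (intro measurable_restrict Z_measurable) auto
  fix F assume F: "\<And>i. i \<in> S \<Longrightarrow> F i \<in> sets (borel :: 'a measure)"
  have P: "Pi\<^sub>E S F \<in> sets (PiM S (\<lambda>_. borel))" using F S by (intro sets_PiM_I_finite) auto
  have "emeasure (distr M (PiM S (\<lambda>_. borel)) (\<lambda>\<omega>. \<lambda>s\<in>S. Z (s + \<tau>) \<omega>)) (Pi\<^sub>E S F)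
      = emeasure M {\<omega> \<in> space M. \<forall>s\<in>S. Z (s + \<tau>) \<omega> \<in> F s}"
    unfolding emeasure_distr[OF m1 P] by (rule arg_cong[where f="emeasure M"]) (auto simp: PiE_iff)
  also have "\<dots> = emeasure M {\<omega> \<in> space M. \<forall>s\<in>S. Z s \<omega> \<in> F s}"
    by (rule rectangle_shift[OF S sh F])
  also have "\<dots> = emeasure (distr M (PiM S (\<lambda>_. borel)) (\<lambda>\<omega>. \<lambda>s\<in>S. Z s \<omega>)) (Pi\<^sub>E S F)"
    unfolding emeasure_distr[OF m2 P] by (rule arg_cong[where f="emeasure M"]) (auto simp: PiE_iff)
  finally show "emeasure (distr M (PiM S (\<lambda>_. borel)) (\<lambda>\<omega>. \<lambda>s\<in>S. Z (s + \<tau>) \<omega>)) (Pi\<^sub>E S F)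
    = emeasure (distr M (PiM S (\<lambda>_. borel)) (\<lambda>\<omega>. \<lambda>s\<in>S. Z s \<omega>)) (Pi\<^sub>E S F)" .
next
  interpret D: prob_space "distr M (PiM S (\<lambda>_. borel)) (\<lambda>\<omega>. \<lambda>s\<in>S. Z (s + \<tau>) \<omega>)"
    using sh by (intro prob_space_distr measurable_restrict Z_measurable) auto
  show "range (\<lambda>_::nat. Pi\<^sub>E S (\<lambda>_. UNIV)) \<subseteq> prod_algebra S (\<lambda>_. borel :: 'a measure)"
    using S by (auto intro!: prod_algebraI_finite)
  show "emeasure (distr M (PiM S (\<lambda>_. borel)) (\<lambda>\<omega>. \<lambda>s\<in>S. Z (s + \<tau>) \<omega>)) (Pi\<^sub>E S (\<lambda>_. UNIV)) \<noteq> \<infinity>"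
    using D.emeasure_finite by simp
qed (use S in \<open>auto simp: space_PiM\<close>)

text \<open>Repeated and unordered times are handled by passing to the set of times and reading off the
  coordinates afterwards.\<close>

lemma fin_dim_shift:
  fixes t :: "nat \<Rightarrow> real"
  assumes t: "\<And>k. k \<in> {1..n} \<Longrightarrow> t k \<in> {0..T}" "\<And>k. k \<in> {1..n} \<Longrightarrow> t k + \<tau> \<in> {0..T}"
  shows "distr M (PiM {1..n} (\<lambda>_. borel)) (\<lambda>\<omega>. \<lambda>k\<in>{1..n}. Z (t k + \<tau>) \<omega>)
       = distr M (PiM {1..n} (\<lambda>_. borel)) (\<lambda>\<omega>. \<lambda>k\<in>{1..n}. Z (t k) \<omega>)"
proof -
  let ?S = "t ` {1..n}" and ?B = "\<lambda>_. borel :: 'a measure"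
  let ?r = "\<lambda>y. \<lambda>k\<in>{1..n}. y (t k)"
  have r: "?r \<in> PiM ?S ?B \<rightarrow>\<^sub>M PiM {1..n} ?B"
    by (intro measurable_restrict measurable_component_singleton) auto
  have m: "(\<lambda>\<omega>. \<lambda>s\<in>?S. Z (s + \<tau>) \<omega>) \<in> M \<rightarrow>\<^sub>M PiM ?S ?B" "(\<lambda>\<omega>. \<lambda>s\<in>?S. Z s \<omega>) \<in> M \<rightarrow>\<^sub>M PiM ?S ?B"
    using t by (intro measurable_restrict Z_measurable; auto)+
  have "distr M (PiM {1..n} ?B) (\<lambda>\<omega>. \<lambda>k\<in>{1..n}. Z (t k + \<tau>) \<omega>)
      = distr (distr M (PiM ?S ?B) (\<lambda>\<omega>. \<lambda>s\<in>?S. Z (s + \<tau>) \<omega>)) (PiM {1..n} ?B) ?r"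
    unfolding distr_distr[OF r m(1)] by (rule distr_cong) (auto simp: restrict_def)
  also have "\<dots> = distr (distr M (PiM ?S ?B) (\<lambda>\<omega>. \<lambda>s\<in>?S. Z s \<omega>)) (PiM {1..n} ?B) ?r"
    using t by (subst joint_law_shift) auto
  also have "\<dots> = distr M (PiM {1..n} ?B) (\<lambda>\<omega>. \<lambda>k\<in>{1..n}. Z (t k) \<omega>)"
    unfolding distr_distr[OF r m(2)] by (rule distr_cong) (auto simp: restrict_def)
  finally show ?thesis .
qed

text \<open>The joint density $c\,g(x,T-s,z)\,g(z,s,x)$ of $Z_0$ and $Z_s$ is strictly positive, so no
  nontrivial event about the initial position can be decided by the position at an interior time.\<close>

lemma two_point_null:
  assumes s: "0 < s" "s < T" and A: "A \<in> sets borel" and B: "B \<in> sets borel"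
    and null: "emeasure M {\<omega> \<in> space M. Z 0 \<omega> \<in> A \<and> Z s \<omega> \<in> B} = 0"
  shows "emeasure lborel A = 0 \<or> emeasure lborel B = 0"
proof (rule ccontr)
  assume neg: "\<not> ?thesis"
  have h1: "s \<in> {0<..T}" and h2: "T - s \<in> {0<..T}" using s by auto
  let ?k = "\<lambda>x z. ennreal (g x (T - s) z) * ennreal (g z s x)"
  have km: "(\<lambda>p. ?k (fst p) (snd p) * indicator B (snd p)) \<in> borel_measurable (lborel \<Otimes>\<^sub>M lborel)"
    using B by (intro borel_measurable_times_ennreal measurable_compose[OF kernel_measurable[OF h1] measurable_ennreal]
         measurable_compose[OF kernel_measurable[OF h2] measurable_ennreal] measurable_compose[OF measurable_snd borel_measurable_indicator]) simp_all
  have kz: "(\<lambda>z. ?k x z * indicator B z) \<in> borel_measurable lborel" for x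
    using B by (intro borel_measurable_times_ennreal measurable_compose[OF kernel_measurable[OF h1] measurable_ennreal]
         measurable_compose[OF kernel_measurable[OF h2] measurable_ennreal] borel_measurable_indicator) simp_all
  have Wm: "(\<lambda>x. \<integral>\<^sup>+ z\<in>B. ?k x z \<partial>lborel) \<in> borel_measurable lborel"
    by (rule lborel.borel_measurable_nn_integral) (use km in \<open>simp only: case_prod_unfold\<close>)
  have W: "(\<integral>\<^sup>+ z\<in>B. ?k x z \<partial>lborel) \<noteq> 0" for x
  proof
    assume "(\<integral>\<^sup>+ z\<in>B. ?k x z \<partial>lborel) = 0"
    then have "AE z in lborel. ?k x z * indicator B z = 0"
      by (subst (asm) nn_integral_0_iff_AE[OF kz])
    then have "AE z in lborel. z \<notin> B"
      by eventually_elim (use kernel_pos[OF h1] kernel_pos[OF h2] in \<open>auto simp: indicator_def ennreal_eq_0_iff dest: leD\<close>)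
    then have "emeasure lborel B = 0" using B by (simp add: AE_iff_null_sets null_setsD1)
    with neg show False by simp
  qed
  have "ennreal c * (\<integral>\<^sup>+ x\<in>A. (\<integral>\<^sup>+ z\<in>B. ?k x z \<partial>lborel) \<partial>lborel) = 0"
    using three_point_law[OF s A B, of UNIV] null by simp
  then have "(\<integral>\<^sup>+ x\<in>A. (\<integral>\<^sup>+ z\<in>B. ?k x z \<partial>lborel) \<partial>lborel) = 0" using c_pos by auto
  moreover have "(\<lambda>x. (\<integral>\<^sup>+ z\<in>B. ?k x z \<partial>lborel) * indicator A x) \<in> borel_measurable lborel"
    using A by (intro borel_measurable_times_ennreal Wm borel_measurable_indicator) simp
  ultimately have "AE x in lborel. (\<integral>\<^sup>+ z\<in>B. ?k x z \<partial>lborel) * indicator A x = 0"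
    by (subst (asm) nn_integral_0_iff_AE)
  then have "AE x in lborel. x \<notin> A"
    by eventually_elim (use W in \<open>auto simp: indicator_def\<close>)
  then have "emeasure lborel A = 0" using A by (simp add: AE_iff_null_sets null_setsD1)
  with neg show False by simp
qed

end

section \<open>Failure of the Markov property\<close>

lemma gen_sigma_subalgebra:
  assumes "\<And>\<tau>. \<tau> \<in> I \<Longrightarrow> Z \<tau> \<in> borel_measurable M"
  shows "subalgebra M (gen_sigma M Z I)"
  unfolding subalgebra_def
proof
  show "space (gen_sigma M Z I) = space M" by (simp add: gen_sigma_def space_measure_of_conv)
  have "{Z \<tau> -` F \<inter> space M | \<tau> F. \<tau> \<in> I \<and> F \<in> sets borel} \<subseteq> sets M"
    using assms by (auto intro: measurable_sets)
  from sets.sigma_sets_subset[OF this] show "sets (gen_sigma M Z I) \<subseteq> sets M"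
    unfolding gen_sigma_def by (subst sets_measure_of) auto
qed

lemma gen_sigma_measurable:
  fixes Z :: "real \<Rightarrow> 'w \<Rightarrow> real ^ 'd"
  assumes "\<tau> \<in> I"
  shows "Z \<tau> \<in> borel_measurable (gen_sigma M Z I)"
proof (rule measurableI)
  let ?G = "{Z \<tau> -` F \<inter> space M | \<tau> F. \<tau> \<in> I \<and> F \<in> sets borel}"
  have sp: "space (gen_sigma M Z I) = space M" by (simp add: gen_sigma_def space_measure_of_conv)
  fix F :: "(real ^ 'd) set" assume "F \<in> sets borel"
  then have "Z \<tau> -` F \<inter> space M \<in> sigma_sets (space M) ?G" using assms by blast
  moreover have "sets (gen_sigma M Z I) = sigma_sets (space M) ?G"
    unfolding gen_sigma_def by (rule sets_measure_of) auto
  ultimately show "Z \<tau> -` F \<inter> space (gen_sigma M Z I) \<in> sets (gen_sigma M Z I)" by (simp add: sp)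
qed simp

text \<open>Every event known from $Z_s$ is of the form $Z_s \in F$, which makes it accessible to the joint
  law of $(Z_0, Z_s)$.\<close>

lemma sets_gen_sigma_single:
  "sets (gen_sigma M Z {s}) = {Z s -` F \<inter> space M | F. F \<in> sets borel}"
proof -
  have "gen_sigma M Z {s} = vimage_algebra (space M) (Z s) borel"
    unfolding gen_sigma_def vimage_algebra_def by simp
  then show ?thesis using sets_vimage_algebra2[of "Z s" "space M" borel] by simp
qed

lemma (in loop_process) loop_closes:
  assumes A: "A \<in> sets borel"
  shows "AE \<omega> in M. Z 0 \<omega> \<in> A \<longleftrightarrow> Z T \<omega> \<in> A"
proof -
  have Zm: "Z 0 \<in> borel_measurable M" "Z T \<in> borel_measurable M" using T_pos Z_measurable by auto
  have "AE \<omega> in M. \<not> (Z 0 \<omega> \<in> B \<and> Z T \<omega> \<in> - B)" if B: "B \<in> sets borel" for B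
  proof (rule AE_I')
    have "{\<omega> \<in> space M. Z 0 \<omega> \<in> B \<and> Z T \<omega> \<in> - B} = (Z 0 -` B \<inter> space M) \<inter> (Z T -` (- B) \<inter> space M)" by auto
    moreover have "\<dots> \<in> sets M" using B by (intro sets.Int measurable_sets[OF Zm(1)] measurable_sets[OF Zm(2)]) auto
    moreover have "emeasure M {\<omega> \<in> space M. Z 0 \<omega> \<in> B \<and> Z T \<omega> \<in> - B} = 0"
      using B by (subst loop_law_two_ends) auto
    ultimately show "{\<omega> \<in> space M. Z 0 \<omega> \<in> B \<and> Z T \<omega> \<in> - B} \<in> null_sets M" by (simp add: null_sets_def)
  qed auto
  from this[of A] this[of "- A"] A have "AE \<omega> in M. \<not> (Z 0 \<omega> \<in> A \<and> Z T \<omega> \<in> - A)" 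
    "AE \<omega> in M. \<not> (Z 0 \<omega> \<in> - A \<and> Z T \<omega> \<in> - (- A))" by auto
  then show ?thesis by eventually_elim auto
qed

text \<open>At time $T$ the process is back at $Z_0$. Given the past up to $s = T/2$ the conditional probability
  of $Z_T \in A$ is therefore the indicator of $Z_0 \in A$. Under the Markov property it would be a
  function of $Z_s$, and so the event $Z_0 \in A$ would be decided by $Z_s$. Positivity of the joint
  density of $(Z_0, Z_s)$ rules this out as soon as neither $A$ nor its complement is a null set.\<close>

lemma loop_process_not_markov:
  fixes Z :: "real \<Rightarrow> 'w \<Rightarrow> real ^ 'd"
  assumes "loop_process M g T c Z"
  shows "\<not> markov_process M T Z"
proof
  interpret loop_process M g T c Z by fact
  assume mk: "markov_process M T Z"
  define A :: "(real ^ 'd) set" where "A = ball 0 1"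
  define s where "s = T / 2"
  have s: "0 < s" "s < T" using T_pos by (auto simp: s_def)
  have A: "A \<in> sets borel" by (simp add: A_def)
  let ?G = "gen_sigma M Z {0..s}" and ?H = "gen_sigma M Z {s}"
  let ?f = "\<lambda>\<omega>. indicator A (Z T \<omega>) :: real" and ?k = "\<lambda>\<omega>. indicator A (Z 0 \<omega>) :: real"
  have subG: "subalgebra M ?G" and subH: "subalgebra M ?H"
    using s Z_measurable by (auto intro!: gen_sigma_subalgebra)
  interpret G: finite_measure_subalgebra M ?G by unfold_locales (rule subG)
  have Z0T: "Z 0 \<in> borel_measurable M" "Z T \<in> borel_measurable M" "Z s \<in> borel_measurable M"
    using s Z_measurable by auto
  have fm: "?f \<in> borel_measurable M" "?k \<in> borel_measurable M"
    using A by (auto intro!: measurable_compose[OF Z0T(1)] measurable_compose[OF Z0T(2)])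
  have b: "(\<lambda>x. indicator A x :: complex) \<in> borel_measurable borel" "bounded (range (\<lambda>x. indicator A x :: complex))"
    using A by (auto simp: bounded_iff indicator_def intro!: exI[of _ 1])
  have "AE \<omega> in M. complex_cond_exp M ?G (\<lambda>w. indicator A (Z T w)) \<omega>
      = complex_cond_exp M ?H (\<lambda>w. indicator A (Z T w)) \<omega>"
    using mk b s unfolding markov_process_def by auto
  then have 1: "AE \<omega> in M. real_cond_exp M ?G ?f \<omega> = real_cond_exp M ?H ?f \<omega>"
  proof eventually_elim
    case (elim \<omega>)
    have "(\<lambda>w. Re (indicator A (Z T w))) = ?f" by (auto simp: indicator_def)
    with elim show ?case by (simp add: complex_cond_exp_def)
  qed
  have 2: "AE \<omega> in M. real_cond_exp M ?G ?f \<omega> = real_cond_exp M ?G ?k \<omega>"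
  proof (rule G.real_cond_exp_cong)
    show "AE \<omega> in M. ?f \<omega> = ?k \<omega>"
      using loop_closes[OF A] by eventually_elim (auto simp: indicator_def)
  qed (use fm in auto)
  have 3: "AE \<omega> in M. real_cond_exp M ?G ?k \<omega> = ?k \<omega>"
  proof (rule G.real_cond_exp_F_meas)
    show "integrable M ?k" by (rule integrable_const_bound[of _ 1]) (use fm in \<open>auto simp: indicator_def\<close>)
    have "Z 0 \<in> borel_measurable ?G" using s by (intro gen_sigma_measurable) auto
    from measurable_compose[OF this borel_measurable_indicator[OF A]]
    show "?k \<in> borel_measurable ?G" .
  qed
  have "{\<omega> \<in> space ?H. real_cond_exp M ?H ?f \<omega> = 1} \<in> sets ?H" by measurable
  then have "{\<omega> \<in> space M. real_cond_exp M ?H ?f \<omega> = 1} \<in> sets ?H"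
    by (simp only: subH[unfolded subalgebra_def, THEN conjunct1])
  \<comment> \<open>the set where the conditional probability given $Z_s$ equals one\<close>
  then obtain F where F: "F \<in> sets borel" "{\<omega> \<in> space M. real_cond_exp M ?H ?f \<omega> = 1} = Z s -` F \<inter> space M"
    unfolding sets_gen_sigma_single by blast
  have dec: "AE \<omega> in M. Z 0 \<omega> \<in> A \<longleftrightarrow> Z s \<omega> \<in> F"
    using 1 2 3 AE_space
  proof eventually_elim
    case (elim \<omega>)
    then have "Z s \<omega> \<in> F \<longleftrightarrow> real_cond_exp M ?H ?f \<omega> = 1" using F(2) by blast
    also have "\<dots> \<longleftrightarrow> Z 0 \<omega> \<in> A" using elim by (auto simp: indicator_def)
    finally show ?case by simp
  qed
  have null: "emeasure M {\<omega> \<in> space M. Z 0 \<omega> \<in> B \<and> Z s \<omega> \<in> C} = 0"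
    if "AE \<omega> in M. \<not> (Z 0 \<omega> \<in> B \<and> Z s \<omega> \<in> C)" for B C
    using that by (rule emeasure_eq_0_AE)
  have "AE \<omega> in M. \<not> (Z 0 \<omega> \<in> A \<and> Z s \<omega> \<in> - F)" "AE \<omega> in M. \<not> (Z 0 \<omega> \<in> - A \<and> Z s \<omega> \<in> F)"
    using dec by (eventually_elim, auto)+
  \<comment> \<open>$F$ and its complement would both be null sets, so the whole space would be one\<close>
  from this[THEN null] have "emeasure lborel A = 0 \<or> emeasure lborel (- F) = 0"
    "emeasure lborel (- A) = 0 \<or> emeasure lborel F = 0"
    using two_point_null[OF s A, of "- F"] two_point_null[OF s, of "- A" F] A F(1) by auto
  moreover have "emeasure lborel A \<noteq> 0"
  proof
    assume "emeasure lborel A = 0"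
    then have "AE y in lborel. y \<notin> A" using A by (intro AE_not_in) (simp add: null_sets_def)
    then have "AE y in lebesgue. y \<notin> A" by (rule AE_completion)
    from AE_lebesgue_ball_ex[OF this, of 1 0] show False by (auto simp: A_def)
  qed
  moreover have split: "\<infinity> \<le> emeasure lborel B + emeasure lborel (- B)" if "B \<in> sets borel" for B :: "(real ^ 'd) set"
  proof -
    have "(\<infinity>::ennreal) = emeasure lborel (B \<union> - B)" by (simp add: Compl_partition)
    also have "\<dots> \<le> emeasure lborel B + emeasure lborel (- B)"
      using that by (intro emeasure_subadditive) auto
    finally show ?thesis .
  qed
  moreover have "emeasure lborel (- A) \<noteq> 0"
    using split[OF A] emeasure_lborel_ball_finite[of "0 :: real ^ 'd" 1] unfolding A_def by auto
  ultimately show False using split[OF F(1)] by auto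
qed

section \<open>The loop process of the diagonal measure\<close>

text \<open>The weight $g(x,T,y)$ in the density of the initial-final measure cancels the denominator of the
  Bernstein formula, and the diagonal measure forces equal end points. What remains is Lebesgue
  measure for the common end point, with normalising constant $c$.\<close>

lemma bernstein_loop_process:
  fixes g :: "real ^ 'd \<Rightarrow> real \<Rightarrow> real ^ 'd \<Rightarrow> real"
    and Z :: "real \<Rightarrow> 'w \<Rightarrow> real ^ 'd"
  assumes T: "0 < T" and eig: "eigen_system V E h" and gr: "greens_function T E h g"
    and assoc: "bernstein_associated g (mu_bar T E g) M T Z"
  shows "loop_process M g T (inverse (partition_function E T)) Z"
proof -
  define c where "c = inverse (partition_function E T)"
  have TT: "T \<in> {0<..T}" using T by simp
  have pos: "0 < g x t y" if "t \<in> {0<..T}" for x t y using gr that by (simp add: greens_function_def)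
  note km = greens_function_measurable[OF gr]
  have gT: "(\<lambda>p. ennreal (c * g (fst p) T (snd p))) \<in> borel_measurable (borel \<Otimes>\<^sub>M borel)"
    by (intro measurable_compose[OF _ measurable_ennreal] borel_measurable_times borel_measurable_const km TT) simp_all
  have diag: "(\<lambda>x. (x, x)) \<in> lborel \<rightarrow>\<^sub>M (borel \<Otimes>\<^sub>M borel)" by simp
  have mu_int: "(\<integral>\<^sup>+ p. f p \<partial>mu_bar T E g) = (\<integral>\<^sup>+ x. ennreal (c * g x T x) * f (x, x) \<partial>lborel)"
    if f: "f \<in> borel_measurable (borel \<Otimes>\<^sub>M borel)" for f
  proof -
    have "(\<integral>\<^sup>+ p. f p \<partial>mu_bar T E g) = (\<integral>\<^sup>+ p. ennreal (c * g (fst p) T (snd p)) * f p \<partial>diagonal_measure)"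
      unfolding mu_bar_def c_def[symmetric] case_prod_unfold
      using gT f by (intro nn_integral_density) (simp_all add: diagonal_measure_def)
    also have "\<dots> = (\<integral>\<^sup>+ x. ennreal (c * g x T x) * f (x, x) \<partial>lborel)"
      unfolding diagonal_measure_def
      using gT f by (subst nn_integral_distr[OF diag]) simp_all
    finally show ?thesis .
  qed
  have "prob_space (mu_bar T E g)" using assoc by (simp add: bernstein_associated_def)
  then have tr: "(\<integral>\<^sup>+ x. ennreal (c * g x T x) \<partial>lborel) = 1"
    using mu_int[of "\<lambda>_. 1"] prob_space.emeasure_space_1 by fastforce
  \<comment> \<open>a nonpositive constant would make the initial-final measure zero\<close>
  have c: "0 < c"
  proof (rule ccontr)
    assume "\<not> 0 < c"
    then have "c * g x T x \<le> 0" for x using pos[OF TT, of x x] by (simp add: mult_nonpos_nonneg less_imp_le)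
    then have "(\<integral>\<^sup>+ x. ennreal (c * g x T x) \<partial>lborel) = 0" by (simp add: ennreal_neg)
    with tr show False by simp
  qed
  have gm: "(\<lambda>x. ennreal (g x T x)) \<in> borel_measurable lborel"
    by (intro measurable_compose[OF _ measurable_ennreal] km TT) simp_all
  have bp: "process_on M T Z" using assoc by (simp add: bernstein_associated_def bernstein_process_def)
  have "loop_process M g T c Z"
  proof (intro loop_process.intro loop_process_axioms.intro)
    show "prob_space M" using bp by (simp add: process_on_def)
    show "0 < T" "0 < c" by fact+
    show "(\<lambda>p. g (fst p) t (snd p)) \<in> borel_measurable (borel \<Otimes>\<^sub>M borel)" if "t \<in> {0<..T}" for t
      using greens_function_regularity(1)[OF gr that] .
    show "0 < g x t y" if "t \<in> {0<..T}" for x t y by (rule pos[OF that])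
    show "(\<integral>\<^sup>+ z. ennreal (g x s z) * ennreal (g z t y) \<partial>lborel) \<le> ennreal (g x (s + t) y)"
      if "0 < s" "0 < t" "s + t \<le> T" for s t x y
      by (rule sub_Chapman_Kolmogorov[OF eig gr that])
    show "ennreal c * (\<integral>\<^sup>+ x. ennreal (g x T x) \<partial>lborel) = 1"
      using tr c pos[OF TT] by (subst nn_integral_cmult[OF gm, symmetric]) (simp add: ennreal_mult less_imp_le)
    show "Z \<tau> \<in> borel_measurable M" if "\<tau> \<in> {0..T}" for \<tau> using bp that by (simp add: process_on_def)
  next
    fix n :: nat and t :: "nat \<Rightarrow> real" and A B :: "(real ^ 'd) set" and F :: "nat \<Rightarrow> (real ^ 'd) set"
    assume t: "increasing_times T n t" and t1: "0 < t 1" and tn: "t n < T"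
      and A: "A \<in> sets borel" and B: "B \<in> sets borel" and F: "\<And>k. k \<in> {1..n} \<Longrightarrow> F k \<in> sets borel"
    let ?P = "PiM {1..n} (\<lambda>_. lborel :: (real ^ 'd) measure)"
    interpret P: sigma_finite_measure ?P by (rule sigma_finite_PiM_lborel) simp
    \<comment> \<open>the Bernstein formula counts the initial time $0$ as the time with index $0$\<close>
    let ?t = "t(0 := 0)"
    have n: "1 \<le> n" and inc: "\<And>k. k \<in> {2..n} \<Longrightarrow> t (k - 1) < t k"
      using t by (auto simp: increasing_times_def)
    note step = increasing_times_gap[OF t]
    have "t 1 \<le> t n" by (rule increasing_times_bounds(1)[OF t n]) simp
    then have h1: "t 1 \<in> {0<..T}" and h2: "T - t n \<in> {0<..T}" using t1 tn by auto
    define k where "k p y = chain_density g n t y * (g (y 1) (t 1) (fst p) * g (snd p) (T - t n) (y n))" for p y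
    define W where "W p = (\<integral>\<^sup>+ y\<in>Pi\<^sub>E {1..n} F. ennreal (k p y) \<partial>?P)" for p
    have km': "(\<lambda>q. k (fst q) (snd q)) \<in> borel_measurable ((borel \<Otimes>\<^sub>M borel) \<Otimes>\<^sub>M ?P)"
    proof -
      have co: "(\<lambda>q. snd q i) \<in> borel_measurable (((borel :: (real ^ 'd) measure) \<Otimes>\<^sub>M (borel :: (real ^ 'd) measure)) \<Otimes>\<^sub>M ?P)"
        if "i \<in> {1..n}" for i
        using measurable_compose[OF measurable_snd
          measurable_component_singleton[OF that, of "\<lambda>_. lborel :: (real ^ 'd) measure"]] by simp
      show ?thesis unfolding k_def chain_density_def
        by (intro borel_measurable_times borel_measurable_prod km step h1 h2 co) (use n in auto)
    qed
    have S: "Pi\<^sub>E {1..n} F \<in> sets ?P" using F by (intro sets_PiM_I_finite) auto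
    have Wm: "W \<in> borel_measurable (borel \<Otimes>\<^sub>M borel)"
      unfolding W_def
    proof (rule P.borel_measurable_nn_integral)
      show "(\<lambda>(p, y). ennreal (k p y) * indicator (Pi\<^sub>E {1..n} F) y) \<in> borel_measurable ((borel \<Otimes>\<^sub>M borel) \<Otimes>\<^sub>M ?P)"
        unfolding case_prod_unfold
        by (intro borel_measurable_times_ennreal measurable_compose[OF km' measurable_ennreal]
            measurable_compose[OF measurable_snd borel_measurable_indicator[OF S]])
    qed
    have prod: "(\<Prod>i=1..n. g ((y(0 := fst p)) i) (?t i - ?t (i - 1)) ((y(0 := fst p)) (i - 1))) * g (snd p) (T - ?t n) (y n) = k p y"
      for p y
    proof -
      have "(\<Prod>i=1..n. g ((y(0 := fst p)) i) (?t i - ?t (i - 1)) ((y(0 := fst p)) (i - 1)))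
         = g (y 1) (t 1) (fst p) * (\<Prod>i=Suc 1..n. g ((y(0 := fst p)) i) (?t i - ?t (i - 1)) ((y(0 := fst p)) (i - 1)))"
        using n by (subst prod.atLeast_Suc_atMost) auto
      also have "(\<Prod>i=Suc 1..n. g ((y(0 := fst p)) i) (?t i - ?t (i - 1)) ((y(0 := fst p)) (i - 1))) = chain_density g n t y"
        unfolding chain_density_def numeral_2_eq_2 by (intro prod.cong) auto
      finally show ?thesis using n by (simp add: k_def mult_ac)
    qed
    have "{\<omega> \<in> space M. Z 0 \<omega> \<in> A \<and> (\<forall>i\<in>{1..n}. Z (t i) \<omega> \<in> F i) \<and> Z T \<omega> \<in> B}
        = {\<omega> \<in> space M. Z 0 \<omega> \<in> A \<and> (\<forall>i\<in>{1..n}. Z (?t i) \<omega> \<in> F i) \<and> Z T \<omega> \<in> B}"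
      by auto
    moreover have "emeasure M {\<omega> \<in> space M. Z 0 \<omega> \<in> A \<and> (\<forall>i\<in>{1..n}. Z (?t i) \<omega> \<in> F i) \<and> Z T \<omega> \<in> B}
        = (\<integral>\<^sup>+ p \<in> A \<times> B. (\<integral>\<^sup>+ y \<in> Pi\<^sub>E {1..n} F. ennreal ((\<Prod>i=1..n. g ((y(0 := fst p)) i) (?t i - ?t (i - 1)) ((y(0 := fst p)) (i - 1)))
                         * g (snd p) (T - ?t n) (y n)) \<partial>?P) / ennreal (g (fst p) T (snd p)) \<partial>mu_bar T E g)"
    proof -
      have "?t (i - 1) < ?t i" if "i \<in> {1..n}" for i
        using that inc[of i] t1 by (cases "i = 1") auto
      then show ?thesis
        by (intro assoc[unfolded bernstein_associated_def, THEN conjunct2, THEN conjunct2, THEN conjunct2, rule_format])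
           (use n tn A B F in auto)
    qed
    ultimately have "emeasure M {\<omega> \<in> space M. Z 0 \<omega> \<in> A \<and> (\<forall>i\<in>{1..n}. Z (t i) \<omega> \<in> F i) \<and> Z T \<omega> \<in> B}
        = (\<integral>\<^sup>+ p \<in> A \<times> B. W p / ennreal (g (fst p) T (snd p)) \<partial>mu_bar T E g)"
      by (simp only: prod W_def)
    also have "\<dots> = (\<integral>\<^sup>+ x. ennreal (c * g x T x) * (W (x, x) / ennreal (g x T x) * indicator (A \<times> B) (x, x)) \<partial>lborel)"
    proof (subst mu_int)
      have "A \<times> B \<in> sets (borel \<Otimes>\<^sub>M borel)" using A B by simp
      then show "(\<lambda>p. W p / ennreal (g (fst p) T (snd p)) * indicator (A \<times> B) p) \<in> borel_measurable (borel \<Otimes>\<^sub>M borel)"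
        by (intro borel_measurable_times_ennreal borel_measurable_divide_ennreal Wm borel_measurable_indicator
            measurable_compose[OF greens_function_regularity(1)[OF gr TT] measurable_ennreal])
    qed simp
    also have "\<dots> = (\<integral>\<^sup>+ x. ennreal c * (W (x, x) * indicator (A \<inter> B) x) \<partial>lborel)"
    proof (rule nn_integral_cong)
      fix x
      have e: "ennreal (g x T x) * (W (x, x) / ennreal (g x T x)) = W (x, x)"
        using pos[OF TT, of x x] by (simp add: ennreal_times_divide mult.commute ennreal_mult_divide_eq)
      have "ennreal (c * g x T x) * (W (x, x) / ennreal (g x T x) * indicator (A \<times> B) (x, x))
         = ennreal c * ((ennreal (g x T x) * (W (x, x) / ennreal (g x T x))) * indicator (A \<times> B) (x, x))"
        using c pos[OF TT, of x x] by (simp add: ennreal_mult mult_ac)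
      also have "\<dots> = ennreal c * (W (x, x) * indicator (A \<inter> B) x)"
        unfolding e by (auto simp: indicator_def)
      finally show "ennreal (c * g x T x) * (W (x, x) / ennreal (g x T x) * indicator (A \<times> B) (x, x))
         = ennreal c * (W (x, x) * indicator (A \<inter> B) x)" .
    qed
    also have "\<dots> = ennreal c * (\<integral>\<^sup>+ x\<in>A \<inter> B. W (x, x) \<partial>lborel)"
    proof (rule nn_integral_cmult)
      show "(\<lambda>x. W (x, x) * indicator (A \<inter> B) x) \<in> borel_measurable lborel"
        using measurable_compose[OF diag Wm] A B
        by (intro borel_measurable_times_ennreal borel_measurable_indicator) auto
    qed
    finally show "emeasure M {\<omega> \<in> space M. Z 0 \<omega> \<in> A \<and> (\<forall>i\<in>{1..n}. Z (t i) \<omega> \<in> F i) \<and> Z T \<omega> \<in> B}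
      = ennreal c * (\<integral>\<^sup>+ x\<in>A \<inter> B. (\<integral>\<^sup>+ y\<in>Pi\<^sub>E {1..n} F.
          ennreal (chain_density g n t y * (g (y 1) (t 1) x * g x (T - t n) (y n))) \<partial>PiM {1..n} (\<lambda>_. lborel)) \<partial>lborel)"
      by (simp add: W_def k_def)
  qed
  then show ?thesis by (simp add: c_def)
qed

theorem corollary1:
  fixes V :: "real ^ 'd \<Rightarrow> real"
    and E :: "nat ^ 'd \<Rightarrow> real"
    and h :: "nat ^ 'd \<Rightarrow> real ^ 'd \<Rightarrow> complex"
    and g :: "real ^ 'd \<Rightarrow> real \<Rightarrow> real ^ 'd \<Rightarrow> real"
    and T :: real
    and M :: "'w measure"
    and Z :: "real \<Rightarrow> 'w \<Rightarrow> real ^ 'd"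
  assumes "0 < T"
    and "hypothesis_H V"
    and "eigen_system V E h"
    and "\<And>t. t \<in> {0<..T} \<Longrightarrow> (\<lambda>m. exp (- t * E m)) summable_on UNIV"
    and "greens_function T E h g"
    and "bernstein_associated g (mu_bar T E g) M T Z"
  shows
    "(stationary_process M T Z \<and> \<not> markov_process M T Z \<and>
      (\<forall>(n::nat)\<ge>2. \<forall>t F.
         0 < t 1 \<longrightarrow> (\<forall>k\<in>{2..n}. t (k - 1) < t k) \<longrightarrow> t n < T \<longrightarrow>
         (\<forall>k\<in>{1..n}. F k \<in> sets borel) \<longrightarrow>
         emeasure M {\<omega> \<in> space M. \<forall>k\<in>{1..n}. Z (t k) \<omega> \<in> F k}
         = ennreal (inverse (partition_function E T)) *
           (\<integral>\<^sup>+ x \<in> Pi\<^sub>E {1..n} F.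
              ennreal ((\<Prod>k=2..n. g (x k) (t k - t (k - 1)) (x (k - 1)))
                       * g (x 1) (T - (t n - t 1)) (x n))
            \<partial>(\<Pi>\<^sub>M k\<in>{1..n}. lborel))))
     \<and> (\<forall>F\<in>sets borel. \<forall>t\<in>{0..T}.
          emeasure M {\<omega> \<in> space M. Z t \<omega> \<in> F}
          = ennreal (inverse (partition_function E T)) * (\<integral>\<^sup>+ x \<in> F. ennreal (g x T x) \<partial>lborel))
     \<and> (\<forall>b :: real ^ 'd \<Rightarrow> complex. \<forall>t\<in>{0..T}.
          b \<in> borel_measurable borel \<longrightarrow> bounded (range b) \<longrightarrow>
          integrable lborel (\<lambda>x. b x * complex_of_real (g x T x)) \<and>
          (LINT \<omega>|M. b (Z t \<omega>))
          = complex_of_real (inverse (partition_function E T))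
            * (LINT x|lborel. b x * complex_of_real (g x T x)))"
proof -
  let ?c = "inverse (partition_function E T)"
  interpret loop_process M g T ?c Z by (rule bernstein_loop_process[OF assms(1,3,5,6)])
  have "process_on M T Z" using assms(6) by (simp add: bernstein_associated_def bernstein_process_def)
  then have stationary: "stationary_process M T Z"
    unfolding stationary_process_def fin_dim_distr_def
    by (intro conjI allI impI fin_dim_shift) simp_all
  have not_markov: "\<not> markov_process M T Z"
    by (rule loop_process_not_markov) unfold_locales
  have fdd: "emeasure M {\<omega> \<in> space M. \<forall>k\<in>{1..n}. Z (t k) \<omega> \<in> F k}
      = ennreal ?c * (\<integral>\<^sup>+ x \<in> Pi\<^sub>E {1..n} F. ennreal ((\<Prod>k=2..n. g (x k) (t k - t (k - 1)) (x (k - 1)))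
          * g (x 1) (T - (t n - t 1)) (x n)) \<partial>(\<Pi>\<^sub>M k\<in>{1..n}. lborel))"
    if "2 \<le> n" "0 < t 1" "\<forall>k\<in>{2..n}. t (k - 1) < t k" "t n < T" "\<forall>k\<in>{1..n}. F k \<in> sets borel"
    for n :: nat and t F
    using loop_law_interior[of n t F] that
    by (simp add: increasing_times_def loop_density_def chain_density_def)
  show ?thesis
    using stationary not_markov fdd one_time_law expectation_one_time by blast
qed

end
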